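(* For $0\le b\le1$ let $\rho_b=D_{\sqrt b}(\gamma_1)\boxplus D_{\sqrt{1-b}}(\gamma_0)$. Then for all $0\le b\le 1$ and $0\le c\le1$, $$\rho_{bc}=D_{\sqrt c}(\rho_b)\boxplus D_{\sqrt{1-c}}(\gamma_0).$$
   Context: $\gamma_0$ is the Wigner semicircle law with density $\frac{1}{2\pi}\sqrt{4-x^2}$ on $[-2,2]$; $\gamma_1$ is the standard normal law $N(0,1)$. For a probability measure $\nu$ on $\mathbb{R}$, $D_\lambda\nu(E)=\nu(\lambda^{-1}E)$ for Borel $E\subset\mathbb{R}$ and $\lambda>0$ (dilation), and $D_0\nu=\delta_0$. $\boxplus$ denotes free additive convolution of probability measures on $\mathbb{R}$. *)

theory Defs
  imports "HOL-Probability.Probability" "HOL-Complex_Analysis.Complex_Analysis"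
begin

definition semicircle_distribution :: "real measure" where
  "semicircle_distribution =
     density lborel (\<lambda>x. ennreal (indicator {-2..2} x * (sqrt (4 - x\<^sup>2) / (2 * pi))))"

text \<open>The dilation is defined as a push-forward. The two lemmas below recover the usual
  description, including the convention that dilating by \<open>0\<close> gives the Dirac measure at \<open>0\<close>.\<close>

definition dilation :: "real \<Rightarrow> real measure \<Rightarrow> real measure" where
  "dilation l M = distr M borel (\<lambda>x. l * x)"

lemma emeasure_dilation:
  assumes "sets M = sets borel" "l > 0" "E \<in> sets borel"
  shows "emeasure (dilation l M) E = emeasure M ((\<lambda>x. inverse l * x) ` E)"
proof -
  have sp: "space M = UNIV"
    using sets_eq_imp_space_eq[OF assms(1)] by simp
  have "(\<lambda>x. l * x) \<in> borel_measurable M"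
    using assms(1) by measurable
  moreover have "(\<lambda>x. l * x) -` E = (\<lambda>x. inverse l * x) ` E"
    using assms(2) by (auto simp: field_simps image_iff intro!: bexI[where x = "l * _"])
  ultimately show ?thesis
    using assms(3) by (simp add: dilation_def emeasure_distr sp)
qed

lemma dilation_zero:
  assumes "prob_space M" "sets M = sets borel"
  shows "dilation 0 M = return borel 0"
  using prob_space.distr_const[OF assms(1), of 0 borel] by (simp add: dilation_def)

definition cauchy_transform :: "real measure \<Rightarrow> complex \<Rightarrow> complex" where
  "cauchy_transform M z = (LINT x|M. 1 / (z - complex_of_real x))"

definition reciprocal_cauchy_transform :: "real measure \<Rightarrow> complex \<Rightarrow> complex" where
  "reciprocal_cauchy_transform M z = 1 / cauchy_transform M z"

definition truncated_cone :: "real \<Rightarrow> real \<Rightarrow> complex set" where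
  "truncated_cone \<alpha> \<beta> = {z. \<beta> < Im z \<and> \<bar>Re z\<bar> < \<alpha> * Im z}"

text \<open>\<open>\<phi>\<close> is the Voiculescu transform of \<open>M\<close> on a truncated cone: \<open>\<phi>(z) = F\<inverse>(z) - z\<close>, where
  \<open>F\<close> is the reciprocal Cauchy transform of \<open>M\<close> on the upper half-plane and \<open>F\<inverse>\<close> is its
  analytic right inverse with \<open>F\<inverse>(z) = z (1 + o(1))\<close> as \<open>z \<rightarrow> \<infinity>\<close> inside the cone. Without the
  asymptotic condition \<open>\<phi>\<close> would not be unique: near an isolated atom of \<open>M\<close>, for instance, \<open>F\<close> has
  another inverse branch defined for large \<open>z\<close>.\<close>

definition is_voiculescu_transform ::
    "real measure \<Rightarrow> real \<Rightarrow> real \<Rightarrow> (complex \<Rightarrow> complex) \<Rightarrow> bool" where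
  "is_voiculescu_transform M \<alpha> \<beta> \<phi> \<longleftrightarrow>
     \<phi> holomorphic_on truncated_cone \<alpha> \<beta> \<and>
     (\<forall>z\<in>truncated_cone \<alpha> \<beta>.
        Im (z + \<phi> z) > 0 \<and> reciprocal_cauchy_transform M (z + \<phi> z) = z) \<and>
     ((\<lambda>z. \<phi> z / z) \<longlongrightarrow> 0) (inf at_infinity (principal (truncated_cone \<alpha> \<beta>)))"

text \<open>The free additive convolution of arbitrary Borel probability measures on the real line, which
  need neither be compactly supported nor have moments: the unique probability measure whose
  Voiculescu transform is the sum of the Voiculescu transforms of \<open>M\<close> and \<open>N\<close> on a common
  truncated cone.\<close>

definition free_convolution :: "real measure \<Rightarrow> real measure \<Rightarrow> real measure"
    (infixl "\<boxplus>" 65) where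
  "M \<boxplus> N = (THE R. real_distribution R \<and>
     (\<exists>\<alpha>>0. \<exists>\<beta>>0. \<exists>\<phi> \<psi>.
        is_voiculescu_transform M \<alpha> \<beta> \<phi> \<and>
        is_voiculescu_transform N \<alpha> \<beta> \<psi> \<and>
        is_voiculescu_transform R \<alpha> \<beta> (\<lambda>z. \<phi> z + \<psi> z)))"

definition rho :: "real \<Rightarrow> real measure" where
  "rho b = dilation (sqrt b) std_normal_distribution
             \<boxplus> dilation (sqrt (1 - b)) semicircle_distribution"

end

theory Submission
  imports Defs
begin

text \<open>The Voiculescu transform of the semicircle law of variance \<open>t\<close> is \<open>t / z\<close>, and that of
  \<open>D\<^sub>s M\<close> is \<open>s \<phi>(z / s)\<close>. Hence both sides have the transform \<open>\<phi>(z) + (1 - bc) / z\<close>, where \<open>\<phi>\<close>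
  belongs to the normal law of variance \<open>bc\<close>, and the transform determines the measure.

  Since free convolution is defined by a definite description, existence has to be shown as well.
  With \<open>G\<close> the Cauchy transform of \<open>M\<close>, Brouwer's theorem and the Cauchy--Schwarz inequality show
  that \<open>w \<mapsto> w + t G(w)\<close> maps a subdomain of the upper half-plane bijectively onto the whole
  half-plane; \<open>G\<close> composed with the inverse map is the Cauchy transform of \<open>M\<close> freely convolved with
  the semicircle law. That it is a Cauchy transform follows from the Poisson formula on the lines
  \<open>Im z = \<epsilon>\<close> and Helly's theorem as \<open>\<epsilon> \<rightarrow> 0\<close>.\<close>

text \<open>The Voiculescu transform of a normal law is never computed. It enters only as an unknown
  \<phi>, known to exist high up in a cone, and the parameters then enter through c (1 - b) + (1 -
  c) = 1 - b c alone. The map w + t G(w) comes from inverting the desired formula: if w = z +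
  \<phi>(z), then G(w) = 1 / z, so the inverse function wanted for the convolution, z + \<phi>(z) +
  t / z, is w + t G(w). G composed with the inverse of that map comes without boundary values on the
  real axis. Shifting it up by \<epsilon> makes it bounded and holomorphic across the axis, which is
  what a contour argument needs; the shift is removed at the level of measures. The description also
  leaves the cone and both transforms free, so any two choices have to be compared. This is done by
  shrinking the cone until F is injective where both inverse branches take their values. In place of
  moments, all estimates in cones rest on one fact: the average of |x / (z - x)| is uniformly small
  high up in a cone.\<close>

lemma Im_le_norm_diff_real: "Im z \<le> norm (z - of_real x)"
  using abs_Im_le_cmod[of "z - of_real x"] by simp

lemma diff_real_nonzero: "0 < Im z \<Longrightarrow> z - of_real x \<noteq> 0"
  using Im_le_norm_diff_real[of z x] by auto

lemma norm_cauchy_kernel_le: "0 < Im z \<Longrightarrow> norm (1 / (z - of_real x)) \<le> 1 / Im z"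
  using Im_le_norm_diff_real[of z x] by (simp add: norm_divide frac_le)

lemma Im_cauchy_kernel: "Im (1 / (z - of_real x)) = - Im z / (norm (z - of_real x))\<^sup>2"
  by (simp add: Im_divide cmod_power2)

lemma open_upper_half_plane: "open {z. 0 < Im z}"
  by (rule open_halfspace_Im_gt)

lemma convex_upper_half_plane: "convex {z. 0 < Im z}"
  by (rule convex_halfspace_Im_gt)

section \<open>Geometry of truncated cones\<close>

lemma mem_truncated_cone: "z \<in> truncated_cone a b \<longleftrightarrow> b < Im z \<and> \<bar>Re z\<bar> < a * Im z"
  by (simp add: truncated_cone_def)

lemma truncated_cone_mono: "a \<le> a' \<Longrightarrow> 0 \<le> b' \<Longrightarrow> b' \<le> b \<Longrightarrow> truncated_cone a b \<subseteq> truncated_cone a' b'"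
  by (force simp: mem_truncated_cone intro: less_le_trans mult_right_mono)

lemma open_truncated_cone: "open (truncated_cone a b)"
proof -
  have "truncated_cone a b = {z. b < Im z} \<inter> {z. \<bar>Re z\<bar> < a * Im z}"
    by (auto simp: mem_truncated_cone)
  moreover have "open {z. \<bar>Re z\<bar> < a * Im z}"
    by (intro open_Collect_less continuous_intros)
  ultimately show ?thesis
    by (simp add: open_halfspace_Im_gt open_Int)
qed

lemma truncated_cone_nonempty: "0 < a \<Longrightarrow> truncated_cone a b \<noteq> {}"
proof -
  assume "0 < a"
  then have "Complex 0 (\<bar>b\<bar> + 1) \<in> truncated_cone a b"
    by (simp add: mem_truncated_cone add_nonneg_pos)
  then show ?thesis by blast
qed

lemma norm_le_of_truncated_cone:
  assumes "z \<in> truncated_cone a b" "0 \<le> b"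
  shows "norm z \<le> (1 + a) * Im z"
proof -
  have "norm z \<le> \<bar>Re z\<bar> + \<bar>Im z\<bar>" by (rule cmod_le)
  then show ?thesis using assms by (simp add: mem_truncated_cone algebra_simps)
qed

text \<open>In a cone |z| is at most (1 + a) Im z, so the displacement is at most Im z / 4. Hence Im
  w \<ge> 3/4 Im z and |Re w| < a Im z + Im z / 4, which the aperture 2 a + 1 and half the height
  accommodate.\<close>

lemma truncated_cone_perturb:
  assumes z: "z \<in> truncated_cone a b" and "0 < a" "0 \<le> b"
    and e: "e * (1 + a) \<le> 1 / 4" and w: "norm (w - z) \<le> e * norm z" and "0 \<le> e"
  shows "w \<in> truncated_cone (2 * a + 1) (b / 2)" "Im z / 2 \<le> Im w"
proof -
  have pos: "0 < Im z" using z \<open>0 \<le> b\<close> by (simp add: mem_truncated_cone)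
  have "e * norm z \<le> e * ((1 + a) * Im z)"
    using norm_le_of_truncated_cone[OF z \<open>0 \<le> b\<close>] \<open>0 \<le> e\<close> by (rule mult_left_mono)
  also have "\<dots> \<le> (1 / 4) * Im z"
    using mult_right_mono[OF e, of "Im z"] pos by (simp add: mult.assoc)
  finally have d: "norm (w - z) \<le> Im z / 4" using w by simp
  have im: "\<bar>Im w - Im z\<bar> \<le> Im z / 4" and re: "\<bar>Re w - Re z\<bar> \<le> Im z / 4"
    using d abs_Im_le_cmod[of "w - z"] abs_Re_le_cmod[of "w - z"] by auto
  have "Im w \<ge> 3 / 4 * Im z" using im by linarith
  then have "(2 * a + 1) * (3 / 4 * Im z) \<le> (2 * a + 1) * Im w"
    using \<open>0 < a\<close> by (intro mult_left_mono) auto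
  moreover have "\<bar>Re w\<bar> < a * Im z + Im z / 4"
    using re z unfolding mem_truncated_cone by linarith
  moreover have "0 < a * Im z" using pos \<open>0 < a\<close> by simp
  ultimately have "\<bar>Re w\<bar> < (2 * a + 1) * Im w"
    using pos by (simp add: algebra_simps)
  then show "w \<in> truncated_cone (2 * a + 1) (b / 2)" "Im z / 2 \<le> Im w"
    using im z pos unfolding mem_truncated_cone by (auto simp: abs_if split: if_splits)
qed

text \<open>Since |z| and Im z are comparable inside a cone, going to infinity there is the same as
  raising the truncation height. All asymptotic conditions are used in this form.\<close>

lemma eventually_truncated_cone_iff:
  assumes "0 < a" "0 < b"
  shows "eventually P (inf at_infinity (principal (truncated_cone a b))) \<longleftrightarrow>
           (\<exists>b'\<ge>b. \<forall>z\<in>truncated_cone a b'. P z)"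
proof
  assume "eventually P (inf at_infinity (principal (truncated_cone a b)))"
  then obtain r where r: "\<And>z. r \<le> norm z \<Longrightarrow> z \<in> truncated_cone a b \<Longrightarrow> P z"
    by (auto simp: eventually_inf_principal eventually_at_infinity)
  have "P z" if "z \<in> truncated_cone a (max r b)" for z
    using that abs_Im_le_cmod[of z] by (intro r) (auto simp: mem_truncated_cone)
  then show "\<exists>b'\<ge>b. \<forall>z\<in>truncated_cone a b'. P z"
    by (intro exI[of _ "max r b"]) auto
next
  assume "\<exists>b'\<ge>b. \<forall>z\<in>truncated_cone a b'. P z"
  then obtain b' where b': "b \<le> b'" "\<And>z. z \<in> truncated_cone a b' \<Longrightarrow> P z" by blast
  have "P z" if z: "z \<in> truncated_cone a b" "(1 + a) * (b' + 1) \<le> norm z" for z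
  proof (rule b'(2))
    have "(1 + a) * (b' + 1) \<le> (1 + a) * Im z"
      using norm_le_of_truncated_cone[OF z(1)] z(2) assms by linarith
    then have "b' + 1 \<le> Im z" using assms by simp
    then show "z \<in> truncated_cone a b'" using z by (simp add: mem_truncated_cone)
  qed
  then show "eventually P (inf at_infinity (principal (truncated_cone a b)))"
    by (auto simp: eventually_inf_principal eventually_at_infinity)
qed

section \<open>The Cauchy transform on the upper half-plane\<close>

context real_distribution begin

lemma norm_integral_le:
  fixes f :: "real \<Rightarrow> 'a::{banach, second_countable_topology}"
  assumes [measurable]: "f \<in> borel_measurable M" and B: "\<And>x. norm (f x) \<le> B"
  shows "norm (LINT x|M. f x) \<le> B"
proof -
  have "integrable M f" using B by (intro integrable_const_bound[of _ B]) auto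
  then have "norm (LINT x|M. f x) \<le> (LINT x|M. norm (f x))"
    by (intro integral_norm_bound)
  also have "\<dots> \<le> (LINT x|M. B)"
    using B \<open>integrable M f\<close> by (intro integral_mono) auto
  finally show ?thesis using prob_space by simp
qed

lemma integrable_cauchy_kernel [simp]:
  "0 < Im z \<Longrightarrow> integrable M (\<lambda>x. 1 / (z - of_real x))"
  by (rule integrable_const_bound[of _ "1 / Im z"]) (auto intro: norm_cauchy_kernel_le)

lemma norm_cauchy_kernel_mult_le:
  assumes "0 < Im z" "0 < Im w"
  shows "norm (1 / ((z - of_real x) * (w - of_real x))) \<le> 1 / Im z * (1 / Im w)"
proof -
  have "norm (1 / (z - of_real x)) * norm (1 / (w - of_real x)) \<le> 1 / Im z * (1 / Im w)"
    using assms by (intro mult_mono norm_cauchy_kernel_le) auto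
  then show ?thesis by (simp add: norm_mult norm_divide)
qed

lemma integrable_cauchy_kernel_mult [simp]:
  assumes "0 < Im z" "0 < Im w"
  shows "integrable M (\<lambda>x. 1 / ((z - of_real x) * (w - of_real x)))"
  by (rule integrable_const_bound[of _ "1 / Im z * (1 / Im w)"])
     (use norm_cauchy_kernel_mult_le[OF assms] in auto)

lemma norm_cauchy_transform_le: "0 < Im z \<Longrightarrow> norm (cauchy_transform M z) \<le> 1 / Im z"
  unfolding cauchy_transform_def by (intro norm_integral_le norm_cauchy_kernel_le) auto

lemma Im_cauchy_transform:
  "0 < Im z \<Longrightarrow> Im (cauchy_transform M z) = - (LINT x|M. Im z / (norm (z - of_real x))\<^sup>2)"
proof -
  assume z: "0 < Im z"
  have "Im (cauchy_transform M z) = (LINT x|M. Im (1 / (z - of_real x)))"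
    unfolding cauchy_transform_def using z by (intro integral_Im[symmetric]) simp
  also have "\<dots> = (LINT x|M. - (Im z / (norm (z - of_real x))\<^sup>2))"
    by (simp only: Im_cauchy_kernel minus_divide_left)
  finally show ?thesis by simp
qed

lemma integrable_poisson_kernel:
  assumes "0 < Im z"
  shows "integrable M (\<lambda>x. Im z / (norm (z - of_real x))\<^sup>2)"
proof -
  have "integrable M (\<lambda>x. - Im (1 / (z - of_real x)))"
    using assms by (intro Bochner_Integration.integrable_minus integrable_Im) simp
  then show ?thesis by (simp only: Im_cauchy_kernel) simp
qed

lemma Im_cauchy_transform_neg: "0 < Im z \<Longrightarrow> Im (cauchy_transform M z) < 0"
proof -
  assume z: "0 < Im z"
  have "(LINT x|M. - (Im z / (norm (z - of_real x))\<^sup>2)) < 0"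
    using integrable_poisson_kernel[OF z] z diff_real_nonzero[OF z]
    by (intro expectation_less) auto
  then show ?thesis using Im_cauchy_transform[OF z] by simp
qed

lemma cauchy_transform_nonzero: "0 < Im z \<Longrightarrow> cauchy_transform M z \<noteq> 0"
  using Im_cauchy_transform_neg[of z] by auto

text \<open>The integrated resolvent identity. It yields differentiability, and it turns both later
  injectivity proofs into an estimate of the integral on the right.\<close>

lemma cauchy_transform_diff:
  assumes z: "0 < Im z" and w: "0 < Im w"
  shows "cauchy_transform M z - cauchy_transform M w =
           (w - z) * (LINT x|M. 1 / ((z - of_real x) * (w - of_real x)))"
proof -
  have "cauchy_transform M z - cauchy_transform M w =
          (LINT x|M. 1 / (z - of_real x) - 1 / (w - of_real x))"
    unfolding cauchy_transform_def using z w by simp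
  also have "\<dots> = (LINT x|M. (w - z) * (1 / ((z - of_real x) * (w - of_real x))))"
    using diff_real_nonzero[OF z] diff_real_nonzero[OF w]
    by (intro Bochner_Integration.integral_cong) (auto simp: field_simps)
  finally show ?thesis by (simp only: integral_mult_right_zero)
qed

lemma cauchy_transform_has_field_derivative:
  assumes z: "0 < Im z"
  shows "(cauchy_transform M has_field_derivative
            - (LINT x|M. 1 / ((z - of_real x) * (z - of_real x)))) (at z)"
  unfolding has_field_derivative_iff
proof (rule Lim_transform_eventually, rule tendstoI)
  define I where "I w = (LINT x|M. 1 / ((w - of_real x) * (z - of_real x)))" for w
  have ev: "eventually (\<lambda>w. w \<in> {w. Im z / 2 < Im w}) (at z)"
    using z by (intro eventually_at_topological[THEN iffD2] exI[of _ "{w. Im z / 2 < Im w}"])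
      (auto simp del: less_divide_eq_numeral1 divide_less_eq_numeral1 intro: open_halfspace_Im_gt)
  show "eventually (\<lambda>w. - I w = (cauchy_transform M w - cauchy_transform M z) / (w - z)) (at z)"
    using ev eventually_neq_at_within[of z]
  proof eventually_elim
    case (elim w)
    then have "0 < Im w" using z by simp
    then show ?case using cauchy_transform_diff[of w z] z elim by (simp add: I_def field_simps)
  qed
  fix e :: real assume e: "0 < e"
  \<comment> \<open>The difference of the two kernels is w - z times three Cauchy kernels, two at z
    and one at w; since Im w > Im z / 2, the last one is at most 2 / Im z.\<close>
  define c where "c = 1 / Im z * (1 / Im z) * (2 / Im z)"
  have c: "0 < c" using z by (simp add: c_def)
  have "eventually (\<lambda>w. dist w z < e / c) (at z)"
    using e c by (intro eventually_at_ball'[THEN eventually_mono, of "e / c"])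
       (auto simp: dist_commute eventually_at)
  then show "eventually (\<lambda>w. dist (- I w) (- (LINT x|M. 1 / ((z - of_real x) * (z - of_real x)))) < e) (at z)"
    using ev
  proof eventually_elim
    case (elim w)
    then have w: "0 < Im w" and w2: "Im z / 2 < Im w" using z by auto
    have alg: "1 / (p * p) - 1 / (q * p) = (q - p) * (1 / p * (1 / p) * (1 / q))"
      if "p \<noteq> 0" "q \<noteq> 0" for p q :: complex
      using that by (simp add: divide_simps)
    have k: "1 / ((z - of_real x) * (z - of_real x)) - 1 / ((w - of_real x) * (z - of_real x)) =
            (w - z) * (1 / (z - of_real x) * (1 / (z - of_real x)) * (1 / (w - of_real x)))" for x
      using alg[OF diff_real_nonzero[OF z, of x] diff_real_nonzero[OF w, of x]] by simp
    have w_le: "norm (1 / (w - of_real x)) \<le> 2 / Im z" for x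
      using z w w2 by (intro order_trans[OF norm_cauchy_kernel_le[OF w]]) (simp add: divide_simps)
    have "norm (1 / ((z - of_real x) * (z - of_real x)) - 1 / ((w - of_real x) * (z - of_real x)))
            \<le> norm (w - z) * c" for x
      unfolding k norm_mult c_def
      using z norm_cauchy_kernel_le[OF z, of x] w_le[of x]
      by (intro mult_mono order_refl mult_nonneg_nonneg) auto
    then have "norm (LINT x|M. 1 / ((z - of_real x) * (z - of_real x)) - 1 / ((w - of_real x) * (z - of_real x)))
            \<le> norm (w - z) * c"
      by (intro norm_integral_le) auto
    also have "\<dots> < e" using elim c by (simp add: dist_norm field_simps)
    finally show ?case
      using z w by (simp add: dist_norm I_def norm_minus_commute)
  qed
qed

lemma holomorphic_cauchy_transform: "cauchy_transform M holomorphic_on {z. 0 < Im z}"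
  using cauchy_transform_has_field_derivative
  by (auto simp: holomorphic_on_def field_differentiable_def intro: has_field_derivative_at_within)

lemma holomorphic_reciprocal_cauchy_transform:
  "reciprocal_cauchy_transform M holomorphic_on {z. 0 < Im z}"
  unfolding reciprocal_cauchy_transform_def[abs_def]
  using cauchy_transform_nonzero by (intro holomorphic_intros holomorphic_cauchy_transform) auto

end

subsection \<open>The Cauchy transform in truncated cones\<close>

context real_distribution begin

text \<open>The constant dominates for all x, the quotient vanishes as the cone is raised; together
  they allow dominated convergence for a measure without moments. The constant arises from |x| \<le>
  |z| + |z - x| and |z| \<le> (1 + a) |z - x|.\<close>

lemma norm_ratio_le_in_truncated_cone:
  assumes z: "z \<in> truncated_cone a b" and "0 < a" "0 < b"
  shows "norm (of_real x / (z - of_real x)) \<le> min (2 + a) (\<bar>x\<bar> / b)"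
proof -
  have pos: "0 < Im z" "b \<le> Im z" using z \<open>0 < b\<close> by (auto simp: mem_truncated_cone)
  have d: "Im z \<le> norm (z - of_real x)" by (rule Im_le_norm_diff_real)
  then have dpos: "0 < norm (z - of_real x)" using pos by linarith
  have "norm z \<le> (1 + a) * norm (z - of_real x)"
    using order_trans[OF norm_le_of_truncated_cone[OF z] mult_left_mono[OF d, of "1 + a"]]
      \<open>0 < a\<close> \<open>0 < b\<close> by simp
  moreover have "\<bar>x\<bar> \<le> norm z + norm (z - of_real x)"
    using norm_triangle_ineq4[of z "z - of_real x"] by simp
  ultimately have "\<bar>x\<bar> \<le> (2 + a) * norm (z - of_real x)" by (simp add: algebra_simps)
  then have "norm (of_real x / (z - of_real x)) \<le> 2 + a"
    using dpos by (simp add: norm_divide divide_simps)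
  moreover have "norm (of_real x / (z - of_real x)) \<le> \<bar>x\<bar> / b"
    using d pos \<open>0 < b\<close> by (auto simp: norm_divide intro!: frac_le)
  ultimately show ?thesis by simp
qed

lemma integrable_ratio:
  assumes z: "z \<in> truncated_cone a b" and "0 < a" "0 < b"
  shows "integrable M (\<lambda>x. of_real x / (z - of_real x))"
  using norm_ratio_le_in_truncated_cone[OF assms]
  by (intro integrable_const_bound[of _ "2 + a"]) auto

text \<open>The pointwise bound depends on z only through the height of the cone, so dominated
  convergence in the height gives smallness uniformly in z.\<close>

lemma ratio_integral_small_in_truncated_cone:
  assumes "0 < a" "0 < e"
  obtains b where "0 < b"
    "\<And>z. z \<in> truncated_cone a b \<Longrightarrow> (LINT x|M. norm (of_real x / (z - of_real x))) \<le> e"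
proof -
  have bnd: "norm (min (2 + a) (\<bar>x\<bar> / y)) \<le> 2 + a" if "0 < y" for x y :: real
  proof -
    have "0 \<le> \<bar>x\<bar> / y" using that by simp
    then have "0 \<le> min (2 + a) (\<bar>x\<bar> / y)" using \<open>0 < a\<close> by simp
    then show ?thesis by simp
  qed
  have "((\<lambda>y. LINT x|M. min (2 + a) (\<bar>x\<bar> / y)) \<longlongrightarrow> (LINT x|M. 0)) at_top"
  proof (rule integral_dominated_convergence_at_top[where w = "\<lambda>_. 2 + a"])
    show "\<forall>\<^sub>F y in at_top. AE x in M. norm (min (2 + a) (\<bar>x\<bar> / y)) \<le> 2 + a"
      by (intro eventually_mono[OF eventually_gt_at_top[of 0]]) (use bnd in auto)
    have "((\<lambda>y. min (2 + a) (\<bar>x\<bar> / y)) \<longlongrightarrow> min (2 + a) 0) at_top" for x :: real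
      by (intro tendsto_min tendsto_const real_tendsto_divide_at_top[where c = "\<bar>x\<bar>"] filterlim_ident)
    then show "AE x in M. ((\<lambda>y. min (2 + a) (\<bar>x\<bar> / y)) \<longlongrightarrow> 0) at_top"
      using \<open>0 < a\<close> by simp
  qed auto
  then have "\<forall>\<^sub>F y in at_top. (LINT x|M. min (2 + a) (\<bar>x\<bar> / y)) < e \<and> 0 < y"
    using \<open>0 < e\<close> by (intro eventually_conj eventually_gt_at_top order_tendstoD(2)[of _ 0]) auto
  then obtain b where b: "0 < b" "(LINT x|M. min (2 + a) (\<bar>x\<bar> / b)) < e"
    by (metis (mono_tags, lifting) eventually_at_top_linorder order_refl)
  show thesis
  proof (rule that)
    fix z assume z: "z \<in> truncated_cone a b"
    have "(LINT x|M. norm (of_real x / (z - of_real x))) \<le> (LINT x|M. min (2 + a) (\<bar>x\<bar> / b))"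
      using integrable_ratio[OF z] norm_ratio_le_in_truncated_cone[OF z] \<open>0 < a\<close> \<open>0 < b\<close>
      by (intro integral_mono integrable_norm integrable_const_bound[of _ "2 + a"]) (use bnd in auto)
    then show "(LINT x|M. norm (of_real x / (z - of_real x))) \<le> e" using b by simp
  qed fact
qed

lemma mult_cauchy_transform_eq:
  assumes z: "z \<in> truncated_cone a b" and "0 < a" "0 < b"
  shows "z * cauchy_transform M z = 1 + (LINT x|M. of_real x / (z - of_real x))"
proof -
  have pos: "0 < Im z" using z \<open>0 < b\<close> by (auto simp: mem_truncated_cone)
  have "z * cauchy_transform M z = (LINT x|M. z * (1 / (z - of_real x)))"
    unfolding cauchy_transform_def by (simp only: integral_mult_right_zero)
  also have "\<dots> = (LINT x|M. 1 + of_real x / (z - of_real x))"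
    using diff_real_nonzero[OF pos] by (intro Bochner_Integration.integral_cong) (auto simp: field_simps)
  also have "\<dots> = 1 + (LINT x|M. of_real x / (z - of_real x))"
    using integrable_ratio[OF assms] prob_space by simp
  finally show ?thesis .
qed

lemma mult_cauchy_transform_near_1:
  assumes "0 < a" "0 < e"
  obtains b where "0 < b" "\<And>z. z \<in> truncated_cone a b \<Longrightarrow> norm (z * cauchy_transform M z - 1) \<le> e"
proof -
  obtain b where b: "0 < b"
    "\<And>z. z \<in> truncated_cone a b \<Longrightarrow> (LINT x|M. norm (of_real x / (z - of_real x))) \<le> e"
    using ratio_integral_small_in_truncated_cone[OF assms] by blast
  show thesis
  proof (rule that)
    fix z assume z: "z \<in> truncated_cone a b"
    show "norm (z * cauchy_transform M z - 1) \<le> e"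
      unfolding mult_cauchy_transform_eq[OF z \<open>0 < a\<close> \<open>0 < b\<close>] add_diff_cancel_left'
      by (rule order_trans[OF integral_norm_bound b(2)[OF z]])
  qed fact
qed

lemma reciprocal_cauchy_transform_near_id:
  assumes "0 < a" "0 < e"
  obtains b where "0 < b"
    "\<And>z. z \<in> truncated_cone a b \<Longrightarrow> norm (z - reciprocal_cauchy_transform M z) \<le> e * norm z"
proof -
  \<comment> \<open>With q = z G(z), the relative error of F is (q - 1) / q. The bound 1/2 keeps |q|
    \<ge> 1/2, and e/2 then gives the error e.\<close>
  obtain b where b: "0 < b"
    "\<And>z. z \<in> truncated_cone a b \<Longrightarrow> norm (z * cauchy_transform M z - 1) \<le> min (1/2) (e/2)"
    using mult_cauchy_transform_near_1[of a "min (1/2) (e/2)"] assms by auto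
  show thesis
  proof (rule that)
    fix z assume z: "z \<in> truncated_cone a b"
    then have pos: "0 < Im z" using \<open>0 < b\<close> by (auto simp: mem_truncated_cone)
    define q where "q = z * cauchy_transform M z"
    have q: "norm (q - 1) \<le> 1/2" "norm (q - 1) \<le> e/2" using b(2)[OF z] by (auto simp: q_def)
    have "norm (1::complex) \<le> norm q + norm (q - 1)"
      using norm_triangle_ineq4[of q "q - 1"] by simp
    then have q2: "1/2 \<le> norm q" using q by simp
    have "z - reciprocal_cauchy_transform M z = z * ((q - 1) / q)"
      using cauchy_transform_nonzero[OF pos] pos
      by (auto simp: reciprocal_cauchy_transform_def q_def right_diff_distrib diff_divide_distrib)
    moreover have "norm ((q - 1) / q) \<le> (e / 2) / (1 / 2)"
      unfolding norm_divide using q q2 \<open>0 < e\<close> by (intro frac_le) auto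
    ultimately show "norm (z - reciprocal_cauchy_transform M z) \<le> e * norm z"
      using mult_left_mono[of "norm ((q - 1) / q)" e "norm z"]
      by (simp only: norm_mult) (simp add: mult.commute)
  qed fact
qed

text \<open>If F took the same value at w \<noteq> z, the resolvent identity would make the integral
  of 1 / ((w - x) (z - x)) vanish. Multiplied by w z, that integral is 1 plus terms that are small
  high up in the cone.\<close>

lemma inj_on_reciprocal_cauchy_transform:
  assumes "0 < a"
  obtains b where "0 < b" "inj_on (reciprocal_cauchy_transform M) (truncated_cone a b)"
proof -
  \<comment> \<open>The three error terms \<open>u\<close>, \<open>v\<close> and
    \<open>u * v\<close> contribute at most e, e and (2 + a) e; their sum is 1/2, which is less than
    1.\<close>
  define e where "e = 1 / (2 * (4 + a))"
  have e: "0 < e" "(4 + a) * e = 1 / 2" using assms by (auto simp: e_def)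
  obtain b where b: "0 < b"
    "\<And>z. z \<in> truncated_cone a b \<Longrightarrow> (LINT x|M. norm (of_real x / (z - of_real x))) \<le> e"
    using ratio_integral_small_in_truncated_cone[OF assms e(1)] by blast
  have "w = z" if w: "w \<in> truncated_cone a b" and z: "z \<in> truncated_cone a b"
    and eq: "reciprocal_cauchy_transform M w = reciprocal_cauchy_transform M z" for w z
  proof (rule ccontr)
    assume "w \<noteq> z"
    have pos: "0 < Im w" "0 < Im z" using w z \<open>0 < b\<close> by (auto simp: mem_truncated_cone)
    have int0: "(LINT x|M. 1 / ((w - of_real x) * (z - of_real x))) = 0"
      using cauchy_transform_diff[OF pos] eq \<open>w \<noteq> z\<close> by (simp add: reciprocal_cauchy_transform_def)
    define u v where "u x = of_real x / (w - of_real x)" and "v x = of_real x / (z - of_real x)" for x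
    have uv: "w * z * (1 / ((w - of_real x) * (z - of_real x))) = 1 + (u x + v x + u x * v x)" for x
      using diff_real_nonzero[OF pos(1), of x] diff_real_nonzero[OF pos(2), of x]
      by (simp add: u_def v_def divide_simps) (simp add: algebra_simps)
    have iu: "integrable M u" "integrable M v"
      using integrable_ratio[OF w \<open>0 < a\<close> \<open>0 < b\<close>] integrable_ratio[OF z \<open>0 < a\<close> \<open>0 < b\<close>]
      by (auto simp: u_def[abs_def] v_def[abs_def])
    have ub: "norm (u x) \<le> 2 + a" for x
      using norm_ratio_le_in_truncated_cone[OF w \<open>0 < a\<close> \<open>0 < b\<close>, of x] by (simp add: u_def)
    \<comment> \<open>For the product, one factor is bounded pointwise by 2 + a and only the other
      one is integrated.\<close>
    have uvb: "norm (u x * v x) \<le> (2 + a) * norm (v x)" for x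
      unfolding norm_mult using ub by (intro mult_right_mono) auto
    have iuv: "integrable M (\<lambda>x. u x * v x)"
    proof (rule Bochner_Integration.integrable_bound)
      show "integrable M (\<lambda>x. (2 + a) * norm (v x))" using iu by simp
      show "AE x in M. norm (u x * v x) \<le> norm ((2 + a) * norm (v x))"
        using uvb \<open>0 < a\<close> by (simp add: norm_mult)
    qed (use iu in auto)
    have "0 = (LINT x|M. w * z * (1 / ((w - of_real x) * (z - of_real x))))"
      using int0 by (simp only: integral_mult_right_zero mult_zero_right)
    also have "\<dots> = 1 + ((LINT x|M. u x) + (LINT x|M. v x) + (LINT x|M. u x * v x))"
      unfolding uv using iu iuv prob_space by simp
    finally have "norm ((LINT x|M. u x) + (LINT x|M. v x) + (LINT x|M. u x * v x)) = 1"
      by (metis add.commute add_eq_0_iff norm_minus_cancel norm_one)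
    moreover have "norm (LINT x|M. u x) \<le> e" "norm (LINT x|M. v x) \<le> e"
      using order_trans[OF integral_norm_bound b(2)[OF w]] order_trans[OF integral_norm_bound b(2)[OF z]]
      by (auto simp: u_def[abs_def] v_def[abs_def])
    moreover have "norm (LINT x|M. u x * v x) \<le> (2 + a) * e"
    proof -
      have "norm (LINT x|M. u x * v x) \<le> (LINT x|M. (2 + a) * norm (v x))"
        using iu iuv uvb by (intro order_trans[OF integral_norm_bound] integral_mono) auto
      also have "\<dots> \<le> (2 + a) * e"
        using b(2)[OF z] \<open>0 < a\<close> by (simp add: v_def)
      finally show ?thesis .
    qed
    ultimately have "1 \<le> e + e + (2 + a) * e"
      using norm_triangle_ineq[of "(LINT x|M. u x) + (LINT x|M. v x)" "LINT x|M. u x * v x"]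
        norm_triangle_ineq[of "LINT x|M. u x" "LINT x|M. v x"] by linarith
    then show False using e by (simp add: algebra_simps)
  qed
  then have "inj_on (reciprocal_cauchy_transform M) (truncated_cone a b)"
    by (auto intro: inj_onI)
  with \<open>0 < b\<close> that show thesis by blast
qed

text \<open>A fixed point of w \<mapsto> z + (w - F(w)) solves F(w) = z. Because F is close to the
  identity, this map sends a disc around z, of radius proportional to |z|, into itself, and
  Brouwer's theorem applies.\<close>

lemma reciprocal_cauchy_transform_solvable:
  assumes "0 < a" "0 < e" and e4: "e * (1 + a) \<le> 1 / 4"
  obtains b where "0 < b" "\<And>z. z \<in> truncated_cone a b \<Longrightarrow>
    \<exists>w. norm (w - z) \<le> e * norm z \<and> reciprocal_cauchy_transform M w = z"
proof -
  have "e \<le> 1 / 4"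
    using e4 \<open>0 < a\<close> \<open>0 < e\<close> by (simp add: algebra_simps) (smt (verit) mult_pos_pos)
  \<comment> \<open>The accuracy e/2 suffices because |w| \<le> 2 |z| on the disc. The wider
    aperture, and the height 2 b chosen for z below, keep the whole disc in the region of this
    estimate.\<close>
  obtain b where b: "0 < b" "\<And>z. z \<in> truncated_cone (2 * a + 1) b \<Longrightarrow>
      norm (z - reciprocal_cauchy_transform M z) \<le> e / 2 * norm z"
    using reciprocal_cauchy_transform_near_id[of "2 * a + 1" "e / 2"] assms by auto
  show thesis
  proof (rule that)
    show "0 < 2 * b" using b by simp
    fix z assume z: "z \<in> truncated_cone a (2 * b)"
    define B where "B = cball z (e * norm z)"
    have B: "w \<in> truncated_cone (2 * a + 1) b" if "w \<in> B" for w
      using truncated_cone_perturb(1)[OF z \<open>0 < a\<close> _ e4, of w] that \<open>0 < b\<close> \<open>0 < e\<close>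
      by (simp add: B_def dist_norm norm_minus_commute)
    obtain w where w: "w \<in> B" "z + (w - reciprocal_cauchy_transform M w) = w"
    proof (rule brouwer[of B "\<lambda>w. z + (w - reciprocal_cauchy_transform M w)"])
      show "compact B" "convex B" "B \<noteq> {}"
        using \<open>0 < e\<close> by (auto simp: B_def not_less)
      have "B \<subseteq> {z. 0 < Im z}" using B \<open>0 < b\<close> by (force simp: mem_truncated_cone)
      then show "continuous_on B (\<lambda>w. z + (w - reciprocal_cauchy_transform M w))"
        by (intro continuous_intros continuous_on_subset[OF holomorphic_on_imp_continuous_on[OF
          holomorphic_reciprocal_cauchy_transform]])
      show "(\<lambda>w. z + (w - reciprocal_cauchy_transform M w)) \<in> B \<rightarrow> B"
      proof
        fix w assume w: "w \<in> B"
        then have "norm w \<le> norm z + e * norm z"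
          using norm_triangle_ineq[of z "w - z"] by (simp add: B_def dist_norm norm_minus_commute)
        also have "\<dots> \<le> 2 * norm z"
          using mult_right_mono[of e 1 "norm z"] \<open>e \<le> 1 / 4\<close> by simp
        finally have "e / 2 * norm w \<le> e / 2 * (2 * norm z)"
          using \<open>0 < e\<close> by (intro mult_left_mono) auto
        with b(2)[OF B[OF w]] show "z + (w - reciprocal_cauchy_transform M w) \<in> B"
          by (simp add: B_def dist_norm norm_minus_commute)
      qed
    qed
    then show "\<exists>w. norm (w - z) \<le> e * norm z \<and> reciprocal_cauchy_transform M w = z"
      by (intro exI[of _ w]) (auto simp: B_def dist_norm norm_minus_commute)
  qed
qed

end

subsection \<open>Stieltjes inversion\<close>

context real_distribution begin

text \<open>By Fubini: on the line of height e the imaginary part of the Cauchy kernel is a Poisson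
  kernel, with antiderivative arctan ((x - s) / e).\<close>

lemma integral_Im_cauchy_transform_line:
  assumes e: "0 < e" and "a \<le> b"
  shows "(LINT x|lborel. indicator {a..b} x * Im (cauchy_transform M (Complex x e))) =
           - (LINT s|M. arctan ((b - s) / e) - arctan ((a - s) / e))"
proof -
  have fin: "emeasure (lborel \<Otimes>\<^sub>M M) ({a..b} \<times> UNIV) < \<infinity>"
    using \<open>a \<le> b\<close> emeasure_space_1 by (subst emeasure_pair_measure_Times) auto
  interpret pair_sigma_finite lborel M ..
  define f :: "real \<Rightarrow> real \<Rightarrow> real" where "f x s = indicator {a..b} x * (e / ((x - s)\<^sup>2 + e\<^sup>2))" for x s
  have pos: "0 < (x - s)\<^sup>2 + e\<^sup>2" for x s using e by (simp add: sum_power2_gt_zero_iff)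
  have inner: "(LINT x|lborel. f x s) = arctan ((b - s) / e) - arctan ((a - s) / e)" for s
  proof -
    have "((\<lambda>x. arctan ((x - s) / e)) has_real_derivative e / ((x - s)\<^sup>2 + e\<^sup>2)) (at x)" for x
    proof -
      have "((\<lambda>x. arctan ((x - s) / e)) has_real_derivative inverse (1 + ((x - s) / e)\<^sup>2) * (1 / e)) (at x)"
        using e by (auto intro!: derivative_eq_intros)
      also have "inverse (1 + ((x - s) / e)\<^sup>2) * (1 / e) = e / ((x - s)\<^sup>2 + e\<^sup>2)"
        using e pos[of x s] by (simp add: divide_simps power2_eq_square)
      finally show ?thesis .
    qed
    moreover have "isCont (\<lambda>x. e / ((x - s)\<^sup>2 + e\<^sup>2)) x" for x
      by (intro continuous_intros) (use e in \<open>auto simp: sum_power2_eq_zero_iff\<close>)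
    ultimately have "(LINT x|lborel. (e / ((x - s)\<^sup>2 + e\<^sup>2)) * indicator {a..b} x) =
        arctan ((b - s) / e) - arctan ((a - s) / e)"
      using \<open>a \<le> b\<close> by (intro integral_FTC_Icc_real) auto
    then show ?thesis by (simp add: f_def mult.commute)
  qed
  have "norm (Complex x e - of_real s) ^ 2 = (x - s)\<^sup>2 + e\<^sup>2" for x s
    by (simp add: cmod_power2)
  then have "(LINT x|lborel. indicator {a..b} x * Im (cauchy_transform M (Complex x e))) =
      (LINT x|lborel. - (LINT s|M. f x s))"
    using e by (intro Bochner_Integration.integral_cong refl) 
      (simp add: Im_cauchy_transform f_def flip: integral_mult_right_zero)
  also have "\<dots> = - (LINT x|lborel. (LINT s|M. f x s))" by simp
  also have "(LINT x|lborel. (LINT s|M. f x s)) = (LINT s|M. (LINT x|lborel. f x s))"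
  proof (rule Fubini_integral[symmetric])
    show "integrable (lborel \<Otimes>\<^sub>M M) (case_prod f)"
    proof (rule integrableI_bounded_set[of "{a..b} \<times> UNIV" _ _ "1 / e"])
      show "case_prod f \<in> borel_measurable (lborel \<Otimes>\<^sub>M M)"
        unfolding f_def by measurable
      show "emeasure (lborel \<Otimes>\<^sub>M M) ({a..b} \<times> UNIV) < \<infinity>"
        by (rule fin)
      have "norm (f x s) \<le> 1 / e" for x s
      proof -
        have "e / ((x - s)\<^sup>2 + e\<^sup>2) \<le> e / e\<^sup>2"
          using e pos by (intro divide_left_mono mult_pos_pos) auto
        then show ?thesis using e pos[of x s] by (auto simp: f_def power2_eq_square split: split_indicator)
      qed
      then show "AE x in lborel \<Otimes>\<^sub>M M. x \<in> {a..b} \<times> UNIV \<longrightarrow> norm (case_prod f x) \<le> 1 / e"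
        by auto
    qed (auto simp: f_def indicator_def intro!: AE_I2)
  qed
  finally show ?thesis by (simp only: inner)
qed

lemma integral_tendsto_bounded:
  assumes lim: "\<And>s. (\<lambda>n. g n s) \<longlonglongrightarrow> h s" and b: "\<And>n s. \<bar>g n s\<bar> \<le> B"
    and [measurable]: "\<And>n. g n \<in> borel_measurable M" "h \<in> borel_measurable M"
  shows "(\<lambda>n. LINT s|M. g n s :: real) \<longlonglongrightarrow> (LINT s|M. h s)"
  using assms by (intro integral_dominated_convergence[where w = "\<lambda>_. B"]) auto

text \<open>As sgn 0 = 0, the mean of sgn (u - s) counts an atom at u by half on each side.
  Approaching u from the right restores the right-continuous distribution function.\<close>

lemma integral_sgn_shift_right:
  "(\<lambda>n. LINT s|M. sgn (u + 1 / Suc n - s)) \<longlonglongrightarrow> 2 * cdf M u - 1"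
proof -
  have "(\<lambda>n. sgn (u + 1 / Suc n - s)) \<longlonglongrightarrow> 2 * indicator {..u} s - 1" for s :: real
  proof (cases "s \<le> u")
    case True
    then have "0 < u + 1 / Suc n - s" for n
      using add_nonneg_pos[of "u - s" "1 / Suc n"] by simp
    then have "sgn (u + 1 / Suc n - s) = 1" for n by (simp only: sgn_pos)
    then show ?thesis using True by simp
  next
    case False
    have "(\<lambda>n. u + 1 / Suc n - s) \<longlonglongrightarrow> u + 0 - s"
      by (intro tendsto_intros LIMSEQ_Suc[OF lim_1_over_n])
    then have "\<forall>\<^sub>F n in sequentially. u + 1 / Suc n - s < 0"
      using False by (intro order_tendstoD) auto
    then have "\<forall>\<^sub>F n in sequentially. sgn (u + 1 / Suc n - s) = -1"
      by eventually_elim (rule sgn_neg)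
    then show ?thesis using False by (simp add: tendsto_eventually)
  qed
  then have "(\<lambda>n. LINT s|M. sgn (u + 1 / Suc n - s)) \<longlonglongrightarrow> (LINT s|M. 2 * indicator {..u} s - 1)"
    by (intro integral_tendsto_bounded[where B = 1]) (auto simp: abs_sgn_eq)
  also have "(LINT s|M. 2 * indicator {..u} s - 1) = 2 * cdf M u - 1"
    using prob_space by (subst Bochner_Integration.integral_diff) 
      (auto simp: cdf_def integrable_indicator_iff less_top[symmetric])
  finally show ?thesis .
qed

text \<open>Stieltjes inversion determines only increments; this limit fixes the additive
  constant.\<close>

lemma integral_sgn_at_bot: "(\<lambda>n. LINT s|M. sgn (- real n - s)) \<longlonglongrightarrow> -1"
proof -
  have "(\<lambda>n. sgn (- real n - s)) \<longlonglongrightarrow> -1" for s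
  proof (rule tendsto_eventually)
    show "\<forall>\<^sub>F n in sequentially. sgn (- real n - s) = -1"
      using eventually_gt_at_top[of "nat \<lceil>- s\<rceil>"] by eventually_elim (simp add: sgn_if; linarith)
  qed
  then have "(\<lambda>n. LINT s|M. sgn (- real n - s)) \<longlonglongrightarrow> (LINT s|M. -1)"
    by (intro integral_tendsto_bounded[where B = 1]) (auto simp: abs_sgn_eq)
  then show ?thesis using prob_space by simp
qed

text \<open>arctan (c / \<epsilon>) tends to \<pi>/2 sgn c as \<epsilon> \<rightarrow> 0, including
  c = 0, so atoms at the endpoints cause no exception.\<close>

lemma integral_Im_cauchy_transform_tendsto:
  assumes "a \<le> b"
  shows "(\<lambda>n. LINT x|lborel. indicator {a..b} x * Im (cauchy_transform M (Complex x (1 / Suc n))))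
            \<longlonglongrightarrow> - (pi / 2 * ((LINT s|M. sgn (b - s)) - (LINT s|M. sgn (a - s))))"
proof -
  have lim: "(\<lambda>n. arctan (c / (1 / Suc n))) \<longlonglongrightarrow> pi / 2 * sgn c" for c :: real
  proof -
    have n: "filterlim (\<lambda>n. real (Suc n)) at_top sequentially"
      by (intro filterlim_compose[OF filterlim_real_sequentially filterlim_Suc])
    consider "c = 0" | "0 < c" | "c < 0" by linarith
    then show ?thesis
    proof cases
      case 2
      then have "filterlim (\<lambda>n. c * real (Suc n)) at_top sequentially"
        by (intro filterlim_tendsto_pos_mult_at_top[OF tendsto_const _ n])
      then show ?thesis using filterlim_compose[OF tendsto_arctan_at_top] 2 by simp
    next
      case 3
      then have "filterlim (\<lambda>n. c * real (Suc n)) at_bot sequentially"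
        by (intro filterlim_tendsto_neg_mult_at_bot[OF tendsto_const _ n])
      then show ?thesis using filterlim_compose[OF tendsto_arctan_at_bot] 3 by simp
    qed simp
  qed
  have b: "\<bar>arctan x - arctan y\<bar> \<le> pi" for x y
    using arctan_bounded[of x] arctan_bounded[of y] by linarith
  have "(\<lambda>n. LINT s|M. arctan ((b - s) / (1 / Suc n)) - arctan ((a - s) / (1 / Suc n)))
      \<longlonglongrightarrow> (LINT s|M. pi / 2 * sgn (b - s) - pi / 2 * sgn (a - s))"
    by (intro integral_tendsto_bounded[where B = pi] tendsto_diff lim b) auto
  also have "(LINT s|M. pi / 2 * sgn (b - s) - pi / 2 * sgn (a - s)) =
      (LINT s|M. pi / 2 * sgn (b - s)) - (LINT s|M. pi / 2 * sgn (a - s))"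
    by (intro Bochner_Integration.integral_diff integrable_const_bound[of _ "pi / 2"])
      (auto simp: abs_mult abs_sgn_eq)
  also have "\<dots> = pi / 2 * ((LINT s|M. sgn (b - s)) - (LINT s|M. sgn (a - s)))"
    by (simp add: right_diff_distrib)
  finally show ?thesis
    using \<open>a \<le> b\<close> by (subst integral_Im_cauchy_transform_line) (auto intro: tendsto_minus)
qed

end

theorem cauchy_transform_unique:
  assumes "real_distribution M" "real_distribution N"
    and eq: "\<And>z. 0 < Im z \<Longrightarrow> cauchy_transform M z = cauchy_transform N z"
  shows "M = N"
proof -
  interpret M: real_distribution M by fact
  interpret N: real_distribution N by fact
  \<comment> \<open>p(u) is the mass to the left of u minus the mass to the right: the distribution
    function, rescaled and taken with its midpoint value at atoms.\<close>
  define p q where "p u = (LINT s|M. sgn (u - s))" and "q u = (LINT s|N. sgn (u - s))" for u :: real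
  have diff: "p b - p a = q b - q a" if "a \<le> b" for a b
  proof -
    have "- (pi / 2 * (p b - p a)) = - (pi / 2 * (q b - q a))"
      using M.integral_Im_cauchy_transform_tendsto[OF that] N.integral_Im_cauchy_transform_tendsto[OF that]
      unfolding p_def q_def by (intro LIMSEQ_unique) (simp_all add: eq)
    then show ?thesis by simp
  qed
  have "p b = q b" for b
  proof -
    have "(\<lambda>n. p b - p (- real n)) \<longlonglongrightarrow> p b - (-1)"
      unfolding p_def by (intro tendsto_diff tendsto_const M.integral_sgn_at_bot)
    moreover have "(\<lambda>n. p b - p (- real n)) \<longlonglongrightarrow> q b - (-1)"
    proof (rule Lim_transform_eventually)
      show "(\<lambda>n. q b - q (- real n)) \<longlonglongrightarrow> q b - (-1)"
        unfolding q_def by (intro tendsto_diff tendsto_const N.integral_sgn_at_bot)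
      show "\<forall>\<^sub>F n in sequentially. q b - q (- real n) = p b - p (- real n)"
        using eventually_ge_at_top[of "nat \<lceil>- b\<rceil>"] by eventually_elim (rule diff[symmetric], linarith)
    qed
    ultimately have "p b - (-1) = q b - (-1)" by (rule LIMSEQ_unique)
    then show ?thesis by simp
  qed
  then have "2 * cdf M u - 1 = 2 * cdf N u - 1" for u
    using M.integral_sgn_shift_right[of u] N.integral_sgn_shift_right[of u]
    unfolding p_def q_def by (intro LIMSEQ_unique) auto
  then show ?thesis
    by (intro cdf_unique assms ext) simp
qed

subsection \<open>Voiculescu transforms\<close>

lemma is_voiculescu_transform_restrict:
  assumes "is_voiculescu_transform M a b \<phi>" "a' \<le> a" "0 < b" "b \<le> b'"
  shows "is_voiculescu_transform M a' b' \<phi>"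
proof -
  have sub: "truncated_cone a' b' \<subseteq> truncated_cone a b"
    using assms by (intro truncated_cone_mono) auto
  then have "inf at_infinity (principal (truncated_cone a' b'))
      \<le> inf at_infinity (principal (truncated_cone a b))"
    by (intro inf_mono) auto
  with sub show ?thesis
    using assms(1) unfolding is_voiculescu_transform_def
    by (blast intro: holomorphic_on_subset tendsto_mono)
qed

lemma is_voiculescu_transform_cong:
  assumes eq: "\<And>z. z \<in> truncated_cone a b \<Longrightarrow> \<phi> z = \<psi> z"
  shows "is_voiculescu_transform M a b \<phi> \<longleftrightarrow> is_voiculescu_transform M a b \<psi>"
proof -
  have "((\<lambda>z. \<phi> z / z) \<longlongrightarrow> 0) (inf at_infinity (principal (truncated_cone a b))) \<longleftrightarrow>
        ((\<lambda>z. \<psi> z / z) \<longlongrightarrow> 0) (inf at_infinity (principal (truncated_cone a b)))"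
    by (intro tendsto_cong) (auto simp: eventually_inf_principal eq)
  then show ?thesis
    using eq unfolding is_voiculescu_transform_def by (simp cong: holomorphic_cong)
qed

lemma tendsto_zero_truncated_cone_iff:
  assumes "0 < a" "0 < b"
  shows "((\<lambda>z. \<phi> z / z) \<longlongrightarrow> 0) (inf at_infinity (principal (truncated_cone a b))) \<longleftrightarrow>
    (\<forall>e>0. \<exists>b'\<ge>b. \<forall>z\<in>truncated_cone a b'. norm (\<phi> z) \<le> e * norm z)"
    (is "?L \<longleftrightarrow> ?R")
proof
  assume L: ?L
  show ?R
  proof (intro allI impI)
    fix e :: real assume "0 < e"
    then obtain b' where b': "b \<le> b'" "\<forall>z\<in>truncated_cone a b'. dist (\<phi> z / z) 0 < e"
      using tendstoD[OF L, of e] unfolding eventually_truncated_cone_iff[OF assms] by blast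
    have "norm (\<phi> z) \<le> e * norm z" if z: "z \<in> truncated_cone a b'" for z
    proof -
      have "z \<noteq> 0" using z b' assms by (auto simp: mem_truncated_cone)
      then show ?thesis using b'(2) z by (auto simp: norm_divide divide_simps intro: less_imp_le)
    qed
    then show "\<exists>b'\<ge>b. \<forall>z\<in>truncated_cone a b'. norm (\<phi> z) \<le> e * norm z"
      using b' by blast
  qed
next
  assume R: ?R
  show ?L
  proof (rule tendstoI)
    fix e :: real assume "0 < e"
    then obtain b' where b': "b \<le> b'" "\<And>z. z \<in> truncated_cone a b' \<Longrightarrow> norm (\<phi> z) \<le> e / 2 * norm z"
      using R[rule_format, of "e / 2"] by auto
    have "dist (\<phi> z / z) 0 < e" if z: "z \<in> truncated_cone a b'" for z
    proof -
      have "0 < norm z" using z b' assms by (auto simp: mem_truncated_cone)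
      then have "norm (\<phi> z) < e * norm z"
        using mult_strict_right_mono[of "e / 2" e "norm z"] \<open>0 < e\<close>
        by (intro le_less_trans[OF b'(2)[OF z]]) auto
      then show ?thesis using \<open>0 < norm z\<close> by (simp add: norm_divide divide_simps)
    qed
    then show "\<forall>\<^sub>F z in inf at_infinity (principal (truncated_cone a b)). dist (\<phi> z / z) 0 < e"
      unfolding eventually_truncated_cone_iff[OF assms] using b'(1) by blast
  qed
qed

lemma is_voiculescu_transform_near_id:
  assumes "is_voiculescu_transform M a b \<phi>" "0 < a" "0 < b" "0 < e"
  obtains b' where "b \<le> b'" "\<And>z. z \<in> truncated_cone a b' \<Longrightarrow> norm (\<phi> z) \<le> e * norm z"
  using assms tendsto_zero_truncated_cone_iff[OF assms(2,3)]
  unfolding is_voiculescu_transform_def by meson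

lemma is_voiculescu_transform_cauchy:
  assumes "is_voiculescu_transform M a b \<phi>" "z \<in> truncated_cone a b"
  shows "cauchy_transform M (z + \<phi> z) = 1 / z"
proof -
  have "1 / cauchy_transform M (z + \<phi> z) = z"
    using assms unfolding is_voiculescu_transform_def reciprocal_cauchy_transform_def by blast
  then show ?thesis by (metis divide_divide_eq_right div_by_1 mult_1)
qed

text \<open>F is injective on a wide cone \<open>S\<close>, so it has a holomorphic inverse
  \<open>k\<close> on the image of \<open>S\<close>. The solutions supplied by Brouwer's theorem lie
  in \<open>S\<close>, hence are values of \<open>k\<close>. This shows at once that the image
  contains a narrower cone and that k(z) is close to z.\<close>

lemma (in real_distribution) is_voiculescu_transform_exists:
  assumes "0 < a"
  obtains b \<phi> where "0 < b" "is_voiculescu_transform M a b \<phi>"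
proof -
  let ?F = "reciprocal_cauchy_transform M"
  obtain b1 where b1: "0 < b1" "inj_on ?F (truncated_cone (2 * a + 1) b1)"
    using inj_on_reciprocal_cauchy_transform[of "2 * a + 1"] assms by auto
  define S where "S = truncated_cone (2 * a + 1) b1"
  have S: "S \<subseteq> {z. 0 < Im z}" using b1 by (auto simp: S_def mem_truncated_cone)
  obtain k where k: "k holomorphic_on ?F ` S" "\<And>z. z \<in> S \<Longrightarrow> k (?F z) = z"
    using holomorphic_has_inverse[OF holomorphic_on_subset[OF
          holomorphic_reciprocal_cauchy_transform S], folded S_def] b1(2) open_truncated_cone
    unfolding S_def by metis
  \<comment> \<open>The largest relative error for which a point near the cone of aperture a stays
    in the wide cone; smaller errors are covered by \<open>min e e0\<close> below.\<close>
  define e0 where "e0 = 1 / (4 * (1 + a))"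
  have e0: "0 < e0" "e0 * (1 + a) \<le> 1 / 4" using assms by (auto simp: e0_def field_simps)
  have near: "\<exists>b>0. \<forall>z\<in>truncated_cone a b. z \<in> ?F ` S \<and> norm (k z - z) \<le> e * norm z"
    if e: "0 < e" "e \<le> e0" for e
  proof -
    have e4: "e * (1 + a) \<le> 1 / 4"
      using e e0 mult_right_mono[of e e0 "1 + a"] assms by linarith
    obtain b where b: "0 < b" "\<And>z. z \<in> truncated_cone a b \<Longrightarrow>
        \<exists>w. norm (w - z) \<le> e * norm z \<and> ?F w = z"
      using reciprocal_cauchy_transform_solvable[OF assms e(1) e4] by blast
    \<comment> \<open>The factor 2 compensates for the halving of the height under perturbation, so
      that w stays above b1.\<close>
    have "z \<in> ?F ` S \<and> norm (k z - z) \<le> e * norm z" if z: "z \<in> truncated_cone a (max b (2 * b1))" for z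
    proof -
      have "z \<in> truncated_cone a b" using z by (simp add: mem_truncated_cone)
      then obtain w where w: "norm (w - z) \<le> e * norm z" "?F w = z" using b(2) by blast
      have "w \<in> truncated_cone (2 * a + 1) (max b (2 * b1) / 2)"
        using truncated_cone_perturb(1)[OF z assms _ e4 w(1)] e b by simp
      then have "w \<in> S" by (simp add: S_def mem_truncated_cone)
      then show ?thesis using k(2)[of w] w by (auto intro: rev_image_eqI)
    qed
    then show ?thesis using b(1) by (intro exI[of _ "max b (2 * b1)"]) auto
  qed
  obtain b where b: "0 < b" "\<And>z. z \<in> truncated_cone a b \<Longrightarrow> z \<in> ?F ` S"
    using near[of e0] e0 by auto
  have "is_voiculescu_transform M a b (\<lambda>z. k z - z)"
    unfolding is_voiculescu_transform_def tendsto_zero_truncated_cone_iff[OF assms b(1)]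
  proof (intro conjI ballI allI impI)
    show "(\<lambda>z. k z - z) holomorphic_on truncated_cone a b"
      using b by (intro holomorphic_intros holomorphic_on_subset[OF k(1)]) auto
  next
    fix z assume "z \<in> truncated_cone a b"
    then obtain w where "w \<in> S" "z = ?F w" using b(2) by blast
    then show "0 < Im (z + (k z - z))" "?F (z + (k z - z)) = z" using k(2) S by auto
  next
    fix e :: real assume e: "0 < e"
    obtain b' where b': "\<And>z. z \<in> truncated_cone a b' \<Longrightarrow> norm (k z - z) \<le> min e e0 * norm z"
      using near[of "min e e0"] e e0 by auto
    have "norm (k z - z) \<le> e * norm z" if z: "z \<in> truncated_cone a (max b b')" for z
      using b'[of z] z mult_right_mono[of "min e e0" e "norm z"] by (auto simp: mem_truncated_cone)
    then show "\<exists>b'\<ge>b. \<forall>z\<in>truncated_cone a b'. norm (k z - z) \<le> e * norm z"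
      by (intro exI[of _ "max b b'"]) auto
  qed
  with b(1) that show thesis by blast
qed

text \<open>The points z + \<phi>(z) and z + \<psi>(z) have the same image z under F. The asymptotic
  condition places both close to z, in a cone where F is injective.\<close>

lemma (in real_distribution) is_voiculescu_transform_unique:
  assumes \<phi>: "is_voiculescu_transform M a b \<phi>" and \<psi>: "is_voiculescu_transform M a' b' \<psi>"
    and pos: "0 < a" "0 < b" "0 < a'" "0 < b'"
  obtains c where "b \<le> c" "b' \<le> c" "\<And>z. z \<in> truncated_cone (min a a') c \<Longrightarrow> \<phi> z = \<psi> z"
proof -
  define A where "A = min a a'"
  define e where "e = 1 / (4 * (1 + A))"
  have A: "0 < A" "A \<le> a" "A \<le> a'" using pos by (auto simp: A_def)
  then have e: "0 < e" "e * (1 + A) \<le> 1 / 4" by (auto simp: e_def field_simps)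
  let ?F = "reciprocal_cauchy_transform M"
  obtain b1 where b1: "0 < b1" "inj_on ?F (truncated_cone (2 * A + 1) b1)"
    using inj_on_reciprocal_cauchy_transform[of "2 * A + 1"] A by auto
  have \<phi>A: "is_voiculescu_transform M A b \<phi>" and \<psi>A: "is_voiculescu_transform M A b' \<psi>"
    using is_voiculescu_transform_restrict[OF \<phi>] is_voiculescu_transform_restrict[OF \<psi>] A pos by auto
  obtain c1 where c1: "b \<le> c1" "\<And>z. z \<in> truncated_cone A c1 \<Longrightarrow> norm (\<phi> z) \<le> e * norm z"
    using is_voiculescu_transform_near_id[OF \<phi>A A(1) pos(2) e(1)] by blast
  obtain c2 where c2: "b' \<le> c2" "\<And>z. z \<in> truncated_cone A c2 \<Longrightarrow> norm (\<psi> z) \<le> e * norm z"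
    using is_voiculescu_transform_near_id[OF \<psi>A A(1) pos(4) e(1)] by blast
  define c where "c = max (max c1 c2) (2 * b1)"
  have "\<phi> z = \<psi> z" if z: "z \<in> truncated_cone A c" for z
  proof -
    have z': "z \<in> truncated_cone A c1" "z \<in> truncated_cone A c2"
      "z \<in> truncated_cone A b" "z \<in> truncated_cone A b'"
      using z c1(1) c2(1) by (auto simp: mem_truncated_cone c_def)
    have near: "w \<in> truncated_cone (2 * A + 1) b1" if "norm (w - z) \<le> e * norm z" for w
      using truncated_cone_perturb(1)[OF z A(1) _ e(2) that] e(1) b1
      by (auto simp: c_def mem_truncated_cone)
    have "?F (z + \<phi> z) = z" "?F (z + \<psi> z) = z"
      using \<phi>A \<psi>A z' unfolding is_voiculescu_transform_def by auto
    then have "?F (z + \<phi> z) = ?F (z + \<psi> z)" by simp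
    moreover have "z + \<phi> z \<in> truncated_cone (2 * A + 1) b1" "z + \<psi> z \<in> truncated_cone (2 * A + 1) b1"
      using near[of "z + \<phi> z"] near[of "z + \<psi> z"] c1(2)[OF z'(1)] c2(2)[OF z'(2)] by simp_all
    ultimately have "z + \<phi> z = z + \<psi> z" by (rule inj_onD[OF b1(2)])
    then show ?thesis by simp
  qed
  moreover have "b \<le> c" "b' \<le> c" using c1 c2 by (auto simp: c_def)
  ultimately show thesis using that unfolding A_def by blast
qed

text \<open>Both Cauchy transforms equal 1 / z at z + \<phi>(z). These points form an open set,
  since F inverts the map and so makes it injective; analytic continuation gives equality on the
  half-plane.\<close>

lemma voiculescu_transform_determines_distribution:
  assumes M: "real_distribution M" and N: "real_distribution N"
    and M\<phi>: "is_voiculescu_transform M a b \<phi>" and N\<phi>: "is_voiculescu_transform N a b \<phi>"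
    and "0 < a" "0 < b"
  shows "M = N"
proof (rule cauchy_transform_unique[OF M N])
  let ?C = "truncated_cone a b"
  define f where "f z = z + \<phi> z" for z
  have hol: "f holomorphic_on ?C"
    using M\<phi> unfolding f_def[abs_def] is_voiculescu_transform_def by (intro holomorphic_intros) auto
  moreover have "inj_on f ?C"
    using M\<phi> unfolding f_def is_voiculescu_transform_def inj_on_def by metis
  ultimately have op: "open (f ` ?C)"
    using open_mapping_thm3 open_truncated_cone by blast
  have sub: "f ` ?C \<subseteq> {z. 0 < Im z}"
    using M\<phi> by (auto simp: f_def is_voiculescu_transform_def)
  have eq: "cauchy_transform M w = cauchy_transform N w" if "w \<in> f ` ?C" for w
    using that is_voiculescu_transform_cauchy[OF M\<phi>] is_voiculescu_transform_cauchy[OF N\<phi>]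
    by (auto simp: f_def)
  have ne: "f ` ?C \<noteq> {}" using truncated_cone_nonempty[OF \<open>0 < a\<close>] by simp
  show "cauchy_transform M z = cauchy_transform N z" if "0 < Im z" for z
    by (rule analytic_continuation_open[OF op open_upper_half_plane ne convex_connected[OF
          convex_upper_half_plane] sub real_distribution.holomorphic_cauchy_transform[OF M]
          real_distribution.holomorphic_cauchy_transform[OF N]]) (use that eq in auto)
qed

subsection \<open>Functions that are Cauchy transforms\<close>

lemma norm_diff_of_real_sq: "(norm (z - of_real x))\<^sup>2 = (Re z - x)\<^sup>2 + (Im z)\<^sup>2"
  by (simp add: cmod_power2)

lemma integrable_lborel_poisson_kernel:
  assumes "0 < Im z"
  shows "integrable lborel (\<lambda>x. Im z / (norm (z - of_real x))\<^sup>2)"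
proof -
  have "integrable lborel (\<lambda>x::real. inverse (1 + x\<^sup>2))"
    using integrable_inverse_1_plus_square by (simp add: set_integrable_def einterval_eq)
  then have "integrable lborel (\<lambda>x. 1 / Im z * inverse (1 + (- Re z / Im z + 1 / Im z * x)\<^sup>2))"
    using assms by (intro Bochner_Integration.integrable_mult_right
      lborel_integrable_real_affine[where f = "\<lambda>x. inverse (1 + x\<^sup>2)"]) auto
  moreover have "1 / Im z * inverse (1 + (- Re z / Im z + 1 / Im z * x)\<^sup>2) =
      Im z / (norm (z - of_real x))\<^sup>2" for x
  proof -
    have "- Re z / Im z + 1 / Im z * x = (x - Re z) / Im z" by (simp add: diff_divide_distrib)
    moreover have "1 + ((x - Re z) / Im z)\<^sup>2 = ((Re z - x)\<^sup>2 + (Im z)\<^sup>2) / (Im z)\<^sup>2"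
      using assms by (simp add: power_divide add_divide_distrib power2_commute)
    ultimately show ?thesis
      using assms by (simp only: norm_diff_of_real_sq) (simp add: power2_eq_square)
  qed
  ultimately show ?thesis by simp
qed

text \<open>The three sides off the real axis have total length r + 2 r + r, and each of their
  points has modulus at least r.\<close>

lemma rectangle_three_sides_bound:
  assumes cont: "continuous_on (path_image (rectpath (Complex (- r) 0) (Complex r r))) q"
    and int: "(q has_contour_integral I) (rectpath (Complex (- r) 0) (Complex r r))"
    and "0 < r" and C: "0 \<le> C"
    and q: "\<And>w. r \<le> norm w \<Longrightarrow> 0 \<le> Im w \<Longrightarrow> norm (q w) \<le> C"
  shows "norm (I - integral {-r..r} (\<lambda>x. q (of_real x))) \<le> 4 * C * r"
proof -
  define a1 a2 a3 a4 where "a1 = Complex (- r) 0" "a2 = Complex r 0" "a3 = Complex r r" "a4 = Complex (- r) r"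
  have rect: "rectpath a1 a3 = linepath a1 a2 +++ linepath a2 a3 +++ linepath a3 a4 +++ linepath a4 a1"
    by (simp add: rectpath_def Let_def a1_a2_a3_a4_def)
  have img: "path_image (rectpath a1 a3) =
      closed_segment a1 a2 \<union> closed_segment a2 a3 \<union> closed_segment a3 a4 \<union> closed_segment a4 a1"
    unfolding rect by (simp add: path_image_join Un_assoc)
  have ci: "q contour_integrable_on linepath a1 a2" "q contour_integrable_on linepath a2 a3"
    "q contour_integrable_on linepath a3 a4" "q contour_integrable_on linepath a4 a1"
    using cont[folded a1_a2_a3_a4_def] unfolding img
    by (auto intro!: contour_integrable_continuous_linepath elim: continuous_on_subset)
  have sum: "I = contour_integral (linepath a1 a2) q + (contour_integral (linepath a2 a3) q +
      (contour_integral (linepath a3 a4) q + contour_integral (linepath a4 a1) q))"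
    using int[folded a1_a2_a3_a4_def, THEN contour_integral_unique] ci unfolding rect by simp
  have seg: "r \<le> norm w" "0 \<le> Im w"
    if "w \<in> closed_segment a2 a3 \<or> w \<in> closed_segment a3 a4 \<or> w \<in> closed_segment a4 a1" for w
  proof -
    have "(Re w = r \<or> Re w = - r \<or> Im w = r) \<and> 0 \<le> Im w"
      using that \<open>0 < r\<close> by (auto simp: closed_segment_same_Re closed_segment_same_Im closed_segment_eq_real_ivl
          a1_a2_a3_a4_def)
    then show "r \<le> norm w" "0 \<le> Im w"
      using abs_Re_le_cmod[of w] abs_Im_le_cmod[of w] \<open>0 < r\<close> by auto
  qed
  have "norm (contour_integral (linepath a2 a3) q) \<le> C * norm (a3 - a2)"
    "norm (contour_integral (linepath a3 a4) q) \<le> C * norm (a4 - a3)"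
    "norm (contour_integral (linepath a4 a1) q) \<le> C * norm (a1 - a4)"
    using ci C seg q by (blast intro!: contour_integral_bound_linepath)+
  moreover have "norm (a3 - a2) = r" "norm (a4 - a3) = 2 * r" "norm (a1 - a4) = r"
    using \<open>0 < r\<close> by (simp_all add: a1_a2_a3_a4_def cmod_def real_sqrt_mult)
  moreover have "contour_integral (linepath a1 a2) q = integral {-r..r} (\<lambda>x. q (of_real x))"
    using \<open>0 < r\<close> contour_integral_linepath_Reals_eq[of a1 a2 q]
    by (simp add: a1_a2_a3_a4_def complex_is_Real_iff)
  ultimately show ?thesis
    using norm_triangle_ineq[of "contour_integral (linepath a2 a3) q"
        "contour_integral (linepath a3 a4) q + contour_integral (linepath a4 a1) q"]
      norm_triangle_ineq[of "contour_integral (linepath a3 a4) q" "contour_integral (linepath a4 a1) q"]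
    unfolding sum by simp
qed

text \<open>Cauchy's integral formula for p(w) 2 i Im z / (w - cnj z), whose value at z is p(z). On
  the real axis, dividing by w - z leaves 2 i times p times the unnormalised Poisson kernel;
  elsewhere the integrand is O(1 / |w|^2), so the other sides of a growing rectangle contribute
  nothing in the limit.\<close>

theorem poisson_formula_upper_half_plane:
  assumes hol: "p holomorphic_on {w. - d < Im w}" and "0 < d"
    and bound: "\<And>w. 0 \<le> Im w \<Longrightarrow> norm (p w) \<le> B" and z: "0 < Im z"
  shows "integrable lborel (\<lambda>x. p (of_real x) * of_real (Im z / (norm (z - of_real x))\<^sup>2))" (is ?int)
    and "p z = (LINT x|lborel. p (of_real x) * of_real (Im z / (norm (z - of_real x))\<^sup>2)) / pi" (is ?eq)
proof -
  define P where "P x = p (of_real x) * of_real (Im z / (norm (z - of_real x))\<^sup>2)" for x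
  have B: "0 \<le> B" using order_trans[OF norm_ge_zero bound[of 0]] by simp
  have contp: "continuous_on UNIV (\<lambda>x. p (of_real x))"
    using \<open>0 < d\<close> by (intro continuous_on_compose2[OF holomorphic_on_imp_continuous_on[OF hol]]
        continuous_intros) auto
  have meas [measurable]: "(\<lambda>x. p (of_real x)) \<in> borel_measurable borel"
    using contp by (rule borel_measurable_continuous_onI)
  have intP: "integrable lborel P"
  proof (rule Bochner_Integration.integrable_bound)
    show "integrable lborel (\<lambda>x. B * (Im z / (norm (z - of_real x))\<^sup>2))"
      by (intro Bochner_Integration.integrable_mult_right integrable_lborel_poisson_kernel z)
    show "P \<in> borel_measurable lborel" unfolding P_def by measurable
    have "norm (P x) \<le> norm (B * (Im z / (norm (z - of_real x))\<^sup>2))" for x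
      unfolding P_def norm_mult using bound[of "of_real x"] B z
      by (intro mult_mono) (auto simp: norm_divide norm_power)
    then show "AE x in lborel. norm (P x) \<le> norm (B * (Im z / (norm (z - of_real x))\<^sup>2))" by simp
  qed
  then show ?int by (simp only: P_def[abs_def])
  define q where "q w = p w * (2 * \<i> * Im z) / (w - cnj z) / (w - z)" for w
  have q_real: "q (of_real x) = 2 * \<i> * P x" for x
  proof -
    have "(of_real x - cnj z) * (of_real x - z) = of_real ((norm (z - of_real x))\<^sup>2)"
      unfolding norm_diff_of_real_sq by (simp add: complex_eq_iff power2_eq_square algebra_simps)
    then show ?thesis
      unfolding q_def P_def divide_divide_eq_left by (simp add: field_simps)
  qed
  \<comment> \<open>The half-plane Im w > -m lies in the domain of p and avoids the second pole cnj
    z.\<close>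
  define m where "m = min d (Im z)"
  define S where "S = {w. - m < Im w}"
  have m: "0 < m" "m \<le> d" "m \<le> Im z" using z \<open>0 < d\<close> by (auto simp: m_def)
  have S: "open S" "convex S" "z \<in> S" "\<And>w. w \<in> S \<Longrightarrow> w \<noteq> cnj z"
    using m z by (auto simp: S_def open_halfspace_Im_gt convex_halfspace_Im_gt)
  have holf: "(\<lambda>w. p w * (2 * \<i> * Im z) / (w - cnj z)) holomorphic_on S"
    using S m by (intro holomorphic_intros holomorphic_on_subset[OF hol]) (auto simp: S_def)
  \<comment> \<open>For this n, points of modulus at least n have distance at least n / 2 from z and
    cnj z. The integrand is then at most 8 B Im z / n^2, over a length 4 n.\<close>
  have main: "norm (2 * pi * \<i> * p z - integral {- real n..real n} (\<lambda>x. q (of_real x))) \<le> 32 * B * Im z / real n"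
    if n: "2 * norm z + 1 \<le> real n" for n
  proof -
    define r where "r = real n"
    have r: "2 * norm z + 1 \<le> r" "0 < r" using n norm_ge_zero[of z] unfolding r_def by linarith+
    let ?g = "rectpath (Complex (- r) 0) (Complex r r)"
    have zbox: "z \<in> box (Complex (- r) 0) (Complex r r)"
      using abs_Re_le_cmod[of z] abs_Im_le_cmod[of z] r z by (auto simp: in_box_complex_iff)
    have img: "path_image ?g \<subseteq> S - {z}"
    proof
      fix w assume "w \<in> path_image ?g"
      then have "w \<in> cbox (Complex (- r) 0) (Complex r r)" "w \<notin> box (Complex (- r) 0) (Complex r r)"
        using path_image_rectpath_cbox_minus_box[of "Complex (- r) 0" "Complex r r"] r by auto
      moreover from this(1) have "0 \<le> Im w" by (simp add: in_cbox_complex_iff)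
      ultimately show "w \<in> S - {z}" using zbox m by (auto simp: S_def)
    qed
    have int: "(q has_contour_integral (2 * pi * \<i> * p z)) ?g"
    proof -
      have "((\<lambda>w. (p w * (2 * \<i> * Im z) / (w - cnj z)) / (w - z)) has_contour_integral
          (2 * pi * \<i> * winding_number ?g z * (p z * (2 * \<i> * Im z) / (z - cnj z)))) ?g"
        using S img by (intro Cauchy_integral_formula_convex_simple[OF S(2) holf]) (auto simp: interior_open)
      moreover have "z - cnj z = 2 * \<i> * Im z" by (simp add: complex_eq_iff)
      ultimately show ?thesis using z zbox by (simp add: q_def[abs_def] winding_number_rectpath)
    qed
    have "continuous_on (S - {z}) (\<lambda>w. p w * (2 * \<i> * Im z) / (w - cnj z))"
      using holf holomorphic_on_imp_continuous_on continuous_on_subset by blast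
    then have "continuous_on (S - {z}) q"
      unfolding q_def[abs_def] by (rule continuous_on_divide) (auto intro: continuous_intros)
    then have cont: "continuous_on (path_image ?g) q" using img continuous_on_subset by blast
    have "norm (q w) \<le> B * (2 * Im z) / (r / 2) / (r / 2)" if w: "r \<le> norm w" "0 \<le> Im w" for w
    proof -
      have "norm w - norm z \<le> norm (w - z)" "norm w - norm z \<le> norm (w - cnj z)"
        using norm_triangle_ineq2[of w z] norm_triangle_ineq2[of w "cnj z"] by auto
      then have "r / 2 \<le> norm (w - z)" "r / 2 \<le> norm (w - cnj z)" using r w by linarith+
      then show ?thesis
        unfolding q_def norm_divide norm_mult using bound[OF w(2)] r z B
        by (intro frac_le mult_mono divide_nonneg_pos mult_nonneg_nonneg) auto
    qed
    then have "norm (2 * pi * \<i> * p z - integral {-r..r} (\<lambda>x. q (of_real x)))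
        \<le> 4 * (B * (2 * Im z) / (r / 2) / (r / 2)) * r"
      using B z r by (intro rectangle_three_sides_bound[OF cont int]) auto
    also have "\<dots> = 32 * B * Im z / r" using r by (simp add: field_simps)
    finally show ?thesis by (simp add: r_def)
  qed
  have lim1: "(\<lambda>n. integral {- real n..real n} (\<lambda>x. q (of_real x))) \<longlonglongrightarrow> 2 * pi * \<i> * p z"
  proof (rule Lim_transform)
    show "(\<lambda>n. 2 * pi * \<i> * p z) \<longlonglongrightarrow> 2 * pi * \<i> * p z" by simp
    show "(\<lambda>n. integral {- real n..real n} (\<lambda>x. q (of_real x)) - 2 * pi * \<i> * p z) \<longlonglongrightarrow> 0"
    proof (rule Lim_null_comparison)
      show "(\<lambda>n. 32 * B * Im z / real n) \<longlonglongrightarrow> 0" by (rule lim_const_over_n)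
      show "\<forall>\<^sub>F n in sequentially. norm (integral {- real n..real n} (\<lambda>x. q (of_real x)) - 2 * pi * \<i> * p z)
          \<le> 32 * B * Im z / real n"
        using eventually_ge_at_top[of "nat \<lceil>2 * norm z + 1\<rceil>"]
      proof eventually_elim
        case (elim n)
        then have "2 * norm z + 1 \<le> real n" by linarith
        from main[OF this] show ?case by (simp only: norm_minus_commute)
      qed
    qed
  qed
  have lim2: "(\<lambda>n. integral {- real n..real n} (\<lambda>x. q (of_real x))) \<longlonglongrightarrow> (LINT x|lborel. 2 * \<i> * P x)"
  proof -
    have "integral {- real n..real n} (\<lambda>x. q (of_real x)) =
        (LINT x|lborel. indicator {- real n..real n} x *\<^sub>R (2 * \<i> * P x))" for n
    proof -
      have "set_integrable lborel {- real n..real n} (\<lambda>x. 2 * \<i> * P x)"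
        unfolding set_integrable_def using intP by (intro integrable_mult_indicator) auto
      from set_borel_integral_eq_integral(2)[OF this] show ?thesis
        unfolding set_lebesgue_integral_def q_real by (rule sym)
    qed
    moreover have "(\<lambda>n. LINT x|lborel. indicator {- real n..real n} x *\<^sub>R (2 * \<i> * P x)) \<longlonglongrightarrow> (LINT x|lborel. 2 * \<i> * P x)"
    proof (rule integral_dominated_convergence[where w = "\<lambda>x. norm (2 * \<i> * P x)"])
      show "AE x in lborel. (\<lambda>n. indicator {- real n..real n} x *\<^sub>R (2 * \<i> * P x)) \<longlonglongrightarrow> 2 * \<i> * P x"
      proof (intro AE_I2 tendsto_eventually)
        fix x :: real
        show "\<forall>\<^sub>F n in sequentially. indicator {- real n..real n} x *\<^sub>R (2 * \<i> * P x) = 2 * \<i> * P x"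
          using eventually_ge_at_top[of "nat \<lceil>\<bar>x\<bar>\<rceil>"]
        proof eventually_elim
          case (elim n)
          then have "\<bar>x\<bar> \<le> real n" by linarith
          then show ?case by (simp add: indicator_def abs_le_iff)
        qed
      qed
    qed (use intP in \<open>auto simp: indicator_def\<close>)
    ultimately show ?thesis by simp
  qed
  have "2 * pi * \<i> * p z = 2 * \<i> * (LINT x|lborel. P x)"
    using LIMSEQ_unique[OF lim1 lim2] by simp
  then have "of_real pi * p z = (LINT x|lborel. P x)" by simp
  then have "p z = (LINT x|lborel. P x) / pi" by (simp add: field_simps)
  then show ?eq by (simp only: P_def)
qed

text \<open>The normalisation that encodes total mass 1 survives an upward shift, because y = (y +
  e) (1 - e / (y + e)).\<close>

lemma tendsto_mult_neg_Im_shift: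
  assumes "((\<lambda>y. y * Im (g (Complex 0 y))) \<longlongrightarrow> -1) at_top" and "0 \<le> e"
  shows "((\<lambda>y. y * Im (g (Complex 0 (y + e)))) \<longlongrightarrow> -1) at_top"
proof (rule Lim_transform_eventually)
  have shift: "filterlim (\<lambda>y. y + e) at_top at_top"
    using filterlim_tendsto_add_at_top[OF tendsto_const[of e at_top] filterlim_ident]
    by (simp add: add.commute)
  have "((\<lambda>y. e / (y + e)) \<longlongrightarrow> 0) at_top"
    by (rule real_tendsto_divide_at_top[OF tendsto_const shift])
  then have "((\<lambda>y. (y + e) * Im (g (Complex 0 (y + e))) * (1 - e / (y + e))) \<longlongrightarrow> -1 * (1 - 0)) at_top"
    using filterlim_compose[OF assms(1) shift] by (intro tendsto_intros)
  then show "((\<lambda>y. (y + e) * Im (g (Complex 0 (y + e))) * (1 - e / (y + e))) \<longlongrightarrow> -1) at_top" by simp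
  show "\<forall>\<^sub>F y in at_top. (y + e) * Im (g (Complex 0 (y + e))) * (1 - e / (y + e)) = y * Im (g (Complex 0 (y + e)))"
    using eventually_gt_at_top[of 0]
  proof eventually_elim
    case (elim y)
    then have "(y + e) * (1 - e / (y + e)) = y" using \<open>0 \<le> e\<close> by (simp add: field_simps)
    then show ?case by (metis mult.assoc mult.commute)
  qed
qed

lemma Im_divide_real: "Im (w / of_real r) = Im w / r"
  by (simp add: Im_divide power2_eq_square)

text \<open>Stieltjes inversion suggests the density - Im p / \<pi>. The Poisson kernel is real, so
  the formula passes to imaginary parts and represents Im p by this density. That the mass is 1
  follows by monotone convergence along the imaginary axis, from the behaviour of y Im p(i
  y).\<close>

lemma poisson_density_distribution:
  assumes hol: "p holomorphic_on {w. - d < Im w}" and "0 < d"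
    and bound: "\<And>w. 0 \<le> Im w \<Longrightarrow> norm (p w) \<le> B"
    and neg: "\<And>x. Im (p (of_real x)) \<le> 0"
    and lim: "((\<lambda>y. y * Im (p (Complex 0 y))) \<longlongrightarrow> -1) at_top"
  obtains R where "real_distribution R" "\<And>z. 0 < Im z \<Longrightarrow> Im (cauchy_transform R z) = Im (p z)"
proof -
  define f where "f x = - Im (p (of_real x)) / pi" for x
  define R where "R = density lborel (\<lambda>x. ennreal (f x))"
  have f0: "0 \<le> f x" for x 
    using neg[of x] unfolding f_def by (intro divide_nonneg_pos) auto
  have "continuous_on UNIV (\<lambda>x. p (of_real x))"
    using \<open>0 < d\<close> by (intro continuous_on_compose2[OF holomorphic_on_imp_continuous_on[OF hol]]
        continuous_intros) auto
  then have "continuous_on UNIV f" unfolding f_def by (intro continuous_intros) auto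
  then have meas [measurable]: "f \<in> borel_measurable borel" by (rule borel_measurable_continuous_onI)
  have int: "integrable lborel (\<lambda>x. f x * (Im z / (norm (z - of_real x))\<^sup>2))"
    and Im_p: "Im (p z) = - (LINT x|lborel. f x * (Im z / (norm (z - of_real x))\<^sup>2))"
    if z: "0 < Im z" for z
  proof -
    let ?P = "\<lambda>x. p (of_real x) * of_real (Im z / (norm (z - of_real x))\<^sup>2)"
    note poisson = poisson_formula_upper_half_plane[OF hol \<open>0 < d\<close> bound z]
    have f: "f x * (Im z / (norm (z - of_real x))\<^sup>2) = - Im (?P x) / pi" for x
      by (simp add: f_def)
    show "integrable lborel (\<lambda>x. f x * (Im z / (norm (z - of_real x))\<^sup>2))"
      unfolding f using poisson(1)
      by (intro Bochner_Integration.integrable_divide Bochner_Integration.integrable_minus integrable_Im)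
    have "Im (p z) = Im (LINT x|lborel. ?P x) / pi"
      by (subst poisson(2)) (simp_all only: Im_divide_real)
    also have "Im (LINT x|lborel. ?P x) = (LINT x|lborel. Im (?P x))"
      by (rule integral_Im[OF poisson(1), symmetric])
    finally show "Im (p z) = - (LINT x|lborel. f x * (Im z / (norm (z - of_real x))\<^sup>2))"
      unfolding f by (simp only: integral_divide_zero Bochner_Integration.integral_minus
          minus_divide_left minus_minus)
  qed
  \<comment> \<open>The density times y^2 / (y^2 + x^2) with y = n + 1. It increases to the density,
    and its integral is - y Im p(i y).\<close>
  define h where "h n x = f x * ((real (Suc n))\<^sup>2 / ((real (Suc n))\<^sup>2 + x\<^sup>2))" for n x
  have pos: "0 < (real (Suc n))\<^sup>2 + x\<^sup>2" for n x by (intro add_pos_nonneg) auto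
  have h: "h n x = real (Suc n) * (f x * (Im (Complex 0 (Suc n)) / (norm (Complex 0 (Suc n) - of_real x))\<^sup>2))" for n x
    by (simp only: norm_diff_of_real_sq) (simp add: h_def power2_eq_square algebra_simps)
  have mass: "integrable lborel f" "(LINT x|lborel. f x) = 1"
  proof -
    have "integrable lborel (h n)" for n
      unfolding h[abs_def] by (intro Bochner_Integration.integrable_mult_right int) simp
    moreover have "mono (\<lambda>n. h n x)" for x
    proof (rule monoI)
      fix m n :: nat assume "m \<le> n"
      then have "(real (Suc m))\<^sup>2 \<le> (real (Suc n))\<^sup>2" by (intro power_mono) auto
      then have "(real (Suc m))\<^sup>2 * ((real (Suc n))\<^sup>2 + x\<^sup>2) \<le> (real (Suc n))\<^sup>2 * ((real (Suc m))\<^sup>2 + x\<^sup>2)"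
        using mult_right_mono[of "(real (Suc m))\<^sup>2" "(real (Suc n))\<^sup>2" "x\<^sup>2"]
        by (simp only: distrib_left mult.commute[of "(real (Suc n))\<^sup>2" "(real (Suc m))\<^sup>2"]) simp
      then have "(real (Suc m))\<^sup>2 / ((real (Suc m))\<^sup>2 + x\<^sup>2) \<le> (real (Suc n))\<^sup>2 / ((real (Suc n))\<^sup>2 + x\<^sup>2)"
        by (simp only: pos_divide_le_eq[OF pos] times_divide_eq_left pos_le_divide_eq[OF pos])
      then show "h m x \<le> h n x" unfolding h_def using f0 by (rule mult_left_mono)
    qed
    moreover have "(\<lambda>n. h n x) \<longlonglongrightarrow> f x" for x
    proof -
      have "real n \<le> (real (Suc n))\<^sup>2 + x\<^sup>2" for n
        using self_le_power[of "real (Suc n)" 2] zero_le_power2[of x] by linarith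
      then have "filterlim (\<lambda>n. (real (Suc n))\<^sup>2 + x\<^sup>2) at_top sequentially"
        by (intro filterlim_at_top_mono[OF filterlim_real_sequentially] always_eventually allI)
      then have "(\<lambda>n. x\<^sup>2 / ((real (Suc n))\<^sup>2 + x\<^sup>2)) \<longlonglongrightarrow> 0"
        by (rule real_tendsto_divide_at_top[OF tendsto_const])
      then have "(\<lambda>n. f x * (1 - x\<^sup>2 / ((real (Suc n))\<^sup>2 + x\<^sup>2))) \<longlonglongrightarrow> f x * (1 - 0)"
        by (intro tendsto_intros)
      moreover have "f x * (1 - x\<^sup>2 / ((real (Suc n))\<^sup>2 + x\<^sup>2)) = h n x" for n
        using pos[of n x] by (simp add: h_def divide_simps)
      ultimately show ?thesis by simp
    qed
    moreover have "(\<lambda>n. LINT x|lborel. h n x) \<longlonglongrightarrow> 1"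
    proof -
      have "(LINT x|lborel. h n x) = - (real (Suc n) * Im (p (Complex 0 (real (Suc n)))))" for n
        unfolding h integral_mult_right_zero using Im_p[of "Complex 0 (real (Suc n))"] by simp
      moreover have "(\<lambda>n. - (real (Suc n) * Im (p (Complex 0 (real (Suc n)))))) \<longlonglongrightarrow> - (-1)"
        by (intro tendsto_minus filterlim_compose[OF lim] filterlim_compose[OF
              filterlim_real_sequentially filterlim_Suc])
      ultimately show ?thesis by simp
    qed
    ultimately show "integrable lborel f" "(LINT x|lborel. f x) = 1"
      by (auto intro!: integrable_monotone_convergence[of lborel h f 1]
          integral_monotone_convergence[of lborel h f 1])
  qed
  have "real_distribution R"
    unfolding real_distribution_def real_distribution_axioms_def
  proof (intro conjI prob_spaceI)
    have "emeasure R (space R) = (\<integral>\<^sup>+ x. ennreal (f x) \<partial>lborel)"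
      by (simp add: R_def emeasure_density)
    also have "\<dots> = ennreal (LINT x|lborel. f x)"
      using mass f0 by (intro nn_integral_eq_integral) auto
    finally show "emeasure R (space R) = 1" using mass by simp
  qed (auto simp: R_def)
  moreover have "Im (cauchy_transform R z) = Im (p z)" if z: "0 < Im z" for z
  proof -
    have "Im (cauchy_transform R z) = - (LINT x|R. Im z / (norm (z - of_real x))\<^sup>2)"
      using real_distribution.Im_cauchy_transform[OF \<open>real_distribution R\<close> z] .
    also have "\<dots> = - (LINT x|lborel. f x *\<^sub>R (Im z / (norm (z - of_real x))\<^sup>2))"
      unfolding R_def using f0 by (subst integral_density) auto
    finally show ?thesis using Im_p[OF z] by simp
  qed
  ultimately show thesis by (rule that)
qed

text \<open>The kernel y^2 / (x^2 + y^2) is at most 1 inside the interval and at most 1/2 outside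
  it. This turns the behaviour of the Cauchy transform on the imaginary axis into tightness.\<close>

lemma (in real_distribution) measure_interval_ge:
  assumes "0 < y"
  shows "measure M {-y<..y} \<ge> - 2 * (y * Im (cauchy_transform M (Complex 0 y))) - 1"
proof -
  have "- (y * Im (cauchy_transform M (Complex 0 y))) = (LINT x|M. y * (y / (norm (Complex 0 y - of_real x))\<^sup>2))"
    using assms by (simp add: Im_cauchy_transform flip: integral_mult_right_zero)
  also have "\<dots> \<le> (LINT x|M. 1 / 2 + 1 / 2 * indicator {-y<..y} x)"
  proof (rule integral_mono)
    have "integrable M (\<lambda>x. y * (Im (Complex 0 y) / (norm (Complex 0 y - of_real x))\<^sup>2))"
      using assms by (intro Bochner_Integration.integrable_mult_right integrable_poisson_kernel) simp
    then show "integrable M (\<lambda>x. y * (y / (norm (Complex 0 y - of_real x))\<^sup>2))" by simp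
    show "integrable M (\<lambda>x. 1 / 2 + 1 / 2 * indicator {-y<..y} x :: real)"
      by (auto simp: integrable_indicator_iff less_top[symmetric])
    fix x
    have pos: "0 < x\<^sup>2 + y\<^sup>2" using assms by (simp add: add_nonneg_pos)
    have eq: "y * (y / (norm (Complex 0 y - of_real x))\<^sup>2) = y\<^sup>2 / (x\<^sup>2 + y\<^sup>2)"
      by (simp only: norm_diff_of_real_sq) (simp add: power2_eq_square)
    show "y * (y / (norm (Complex 0 y - of_real x))\<^sup>2) \<le> 1 / 2 + 1 / 2 * indicator {-y<..y} x"
    proof (cases "x \<in> {-y<..y}")
      case True
      have "y\<^sup>2 / (x\<^sup>2 + y\<^sup>2) \<le> 1" using pos by simp
      then show ?thesis using True by (simp only: eq) simp
    next
      case False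
      then have "y\<^sup>2 \<le> x\<^sup>2" using assms by (intro abs_le_square_iff[THEN iffD1]) auto
      then have "y\<^sup>2 / (x\<^sup>2 + y\<^sup>2) \<le> 1 / 2" using pos by (simp add: divide_simps)
      then show ?thesis using False by (simp only: eq) simp
    qed
  qed
  also have "\<dots> = 1 / 2 + 1 / 2 * measure M {-y<..y}"
    using prob_space by (subst Bochner_Integration.integral_add)
      (auto simp: integrable_indicator_iff less_top[symmetric])
  finally show ?thesis by simp
qed

text \<open>By the open mapping theorem, the image of a nonconstant f would contain a point f(z) + i
  e / 2 off the real axis.\<close>

lemma holomorphic_Im_zero_const:
  assumes "f holomorphic_on S" "open S" "connected S" "\<And>z. z \<in> S \<Longrightarrow> Im (f z) = 0"
  shows "f constant_on S"
proof (rule ccontr)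
  assume nc: "\<not> f constant_on S"
  then have op: "open (f ` S)"
    using open_mapping_thm[OF assms(1-3,2)] by simp
  obtain z where z: "z \<in> S" using nc by (auto simp: constant_on_def)
  then obtain e where e: "0 < e" "ball (f z) e \<subseteq> f ` S"
    using op open_contains_ball by blast
  have "f z + \<i> * of_real (e / 2) \<in> ball (f z) e"
    using e by (simp add: dist_norm norm_mult)
  then have "f z + \<i> * of_real (e / 2) \<in> f ` S" using e(2) by (rule subsetD[rotated])
  then obtain x where x: "f z + \<i> * of_real (e / 2) = f x" "x \<in> S" by blast
  then have "Im (f z + \<i> * of_real (e / 2)) = 0" using assms(4) by metis
  then show False using assms(4)[OF z] e by simp
qed

text \<open>Each shift g(z + i \<epsilon>) is bounded by 1 / \<epsilon> and holomorphic across the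
  real axis, so its imaginary part comes from a measure. These measures are tight, and a weak limit
  Q has the imaginary part of g. The real constant that remains vanishes because both functions are
  bounded by 1 / Im z.\<close>

theorem cauchy_transform_characterization:
  assumes hol: "g holomorphic_on {z. 0 < Im z}"
    and neg: "\<And>z. 0 < Im z \<Longrightarrow> Im (g z) \<le> 0"
    and bound: "\<And>z. 0 < Im z \<Longrightarrow> norm (g z) \<le> 1 / Im z"
    and lim: "((\<lambda>y. y * Im (g (Complex 0 y))) \<longlongrightarrow> -1) at_top"
  obtains R where "real_distribution R" "\<And>z. 0 < Im z \<Longrightarrow> cauchy_transform R z = g z"
proof -
  define \<epsilon> where "\<epsilon> n = 1 / real (Suc n)" for n
  have \<epsilon>: "0 < \<epsilon> n" "\<epsilon> n \<le> 1" for n by (auto simp: \<epsilon>_def)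
  have "\<exists>R. real_distribution R \<and> (\<forall>z. 0 < Im z \<longrightarrow> Im (cauchy_transform R z) = Im (g (z + \<i> * \<epsilon> n)))" for n
  proof -
    let ?p = "\<lambda>z. g (z + \<i> * \<epsilon> n)"
    have 1: "?p holomorphic_on {w. - \<epsilon> n < Im w}"
      by (rule holomorphic_on_compose_gen[OF _ hol, unfolded o_def]) (auto intro!: holomorphic_intros)
    have 2: "norm (?p w) \<le> 1 / \<epsilon> n" if "0 \<le> Im w" for w
    proof -
      have "norm (?p w) \<le> 1 / (Im w + \<epsilon> n)"
        using bound[of "w + \<i> * \<epsilon> n"] that \<epsilon>(1)[of n] by simp
      also have "\<dots> \<le> 1 / \<epsilon> n" using that \<epsilon>(1)[of n] by (simp add: frac_le)
      finally show ?thesis .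
    qed
    have 3: "Im (?p (of_real x)) \<le> 0" for x
      using neg[of "of_real x + \<i> * \<epsilon> n"] \<epsilon>(1)[of n] by simp
    have "Complex 0 y + \<i> * \<epsilon> n = Complex 0 (y + \<epsilon> n)" for y by (simp add: complex_eq_iff)
    then have 4: "((\<lambda>y. y * Im (?p (Complex 0 y))) \<longlongrightarrow> -1) at_top"
      using tendsto_mult_neg_Im_shift[OF lim, of "\<epsilon> n"] \<epsilon>(1)[of n] by simp
    show ?thesis
      by (rule poisson_density_distribution[OF 1 \<epsilon>(1)[of n] 2 3 4]) auto
  qed
  then obtain R where R: "\<And>n. real_distribution (R n)"
    "\<And>n z. 0 < Im z \<Longrightarrow> Im (cauchy_transform (R n) z) = Im (g (z + \<i> * \<epsilon> n))"
    by metis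
  have "tight R"
    unfolding tight_def
  proof (intro conjI allI impI R)
    fix e :: real assume "0 < e"
    \<comment> \<open>With \<open>v\<close> as below, (y + \<epsilon>) v > 1 - e' and \<epsilon>
      \<le> 1 \<le> e' y give y v > 1 - 2 e'. The interval then has mass above 1 - 4 e', and the
      same y serves every n.\<close>
    define e' where "e' = min (1 / 2) (e / 4)"
    have e': "0 < e'" "e' \<le> 1 / 2" "4 * e' \<le> e" using \<open>0 < e\<close> by (auto simp: e'_def)
    have "\<forall>\<^sub>F y in at_top. y * Im (g (Complex 0 y)) < - 1 + e'"
      using e' by (intro order_tendstoD[OF lim]) simp
    then obtain y0 where y0: "\<And>y. y0 \<le> y \<Longrightarrow> y * Im (g (Complex 0 y)) < - 1 + e'"
      by (auto simp: eventually_at_top_linorder)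
    define y where "y = max 1 (max y0 (1 / e'))"
    have "0 < y" "y0 \<le> y" "1 / e' \<le> y" by (auto simp: y_def)
    then have y: "0 < y" "y0 \<le> y" "1 \<le> e' * y" using e' by (auto simp: field_simps)
    have "1 - e < measure (R n) {-y<..y}" for n
    proof -
      define v where "v = - Im (g (Complex 0 (y + \<epsilon> n)))"
      have "1 - e' < (y + \<epsilon> n) * v"
        using y0[of "y + \<epsilon> n"] y \<epsilon>[of n] by (simp add: v_def)
      moreover have "0 \<le> v" using neg[of "Complex 0 (y + \<epsilon> n)"] y \<epsilon>[of n] by (simp add: v_def)
      moreover have "\<epsilon> n \<le> e' * y" using \<epsilon>[of n] y by linarith
      then have "(y + \<epsilon> n) * v \<le> (1 + e') * y * v"
        using \<open>0 \<le> v\<close> by (intro mult_right_mono) (auto simp: algebra_simps)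
      ultimately have "1 - e' < (1 + e') * (y * v)" by (simp add: mult.assoc)
      moreover have "(1 + e') * (1 - 2 * e') \<le> 1 - e'" using e' by (simp add: algebra_simps)
      ultimately have "(1 + e') * (1 - 2 * e') < (1 + e') * (y * v)" by linarith
      then have "1 - 2 * e' < y * v" using e' by simp
      moreover have "Complex 0 y + \<i> * \<epsilon> n = Complex 0 (y + \<epsilon> n)" by (simp add: complex_eq_iff)
      then have "- 2 * (y * - v) - 1 \<le> measure (R n) {-y<..y}"
        using real_distribution.measure_interval_ge[OF R(1) y(1), of n] R(2)[of "Complex 0 y" n] y(1)
        by (simp add: v_def)
      ultimately show ?thesis using e' by linarith
    qed
    then show "\<exists>a b. a < b \<and> (\<forall>n. 1 - e < measure (R n) {a<..b})"
      using y by (intro exI[of _ "-y"] exI[of _ y]) auto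
  qed
  then obtain r Q where r: "strict_mono (r :: nat \<Rightarrow> nat)" and Q: "real_distribution Q"
    and conv: "weak_conv_m (R \<circ> r) Q"
    using tight_imp_convergent_subsubsequence[of R id] by (auto simp: strict_mono_def)
  have Im_eq: "Im (cauchy_transform Q z) = Im (g z)" if z: "0 < Im z" for z
  proof (rule LIMSEQ_unique)
    have "(\<lambda>n. LINT x|(R \<circ> r) n. 1 / (z - of_real x)) \<longlonglongrightarrow> (LINT x|Q. 1 / (z - of_real x))"
    proof (rule weak_conv_imp_integral_bdd_continuous_conv[OF _ Q conv])
      show "isCont (\<lambda>x. 1 / (z - of_real x)) x" for x
        using diff_real_nonzero[OF z] by (intro continuous_intros) auto
    qed (use R norm_cauchy_kernel_le[OF z] in auto)
    then show "(\<lambda>n. Im (cauchy_transform (R (r n)) z)) \<longlonglongrightarrow> Im (cauchy_transform Q z)"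
      unfolding cauchy_transform_def by (intro tendsto_Im) simp
    have "(\<lambda>n. \<epsilon> (r n)) \<longlonglongrightarrow> 0"
      unfolding \<epsilon>_def by (rule LIMSEQ_subseq_LIMSEQ[OF LIMSEQ_Suc[OF lim_1_over_n] r, unfolded o_def])
    then have "(\<lambda>n. z + \<i> * \<epsilon> (r n)) \<longlonglongrightarrow> z + \<i> * of_real 0" by (intro tendsto_intros)
    moreover have "isCont g z"
      using hol z holomorphic_on_imp_continuous_on open_upper_half_plane continuous_on_eq_continuous_at by blast
    ultimately have "(\<lambda>n. Im (g (z + \<i> * \<epsilon> (r n)))) \<longlonglongrightarrow> Im (g z)"
      by (intro tendsto_Im isCont_tendsto_compose[of z g]) auto
    then show "(\<lambda>n. Im (cauchy_transform (R (r n)) z)) \<longlonglongrightarrow> Im (g z)"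
      using R(2)[OF z] by simp
  qed
  have "(\<lambda>z. cauchy_transform Q z - g z) constant_on {z. 0 < Im z}"
    using real_distribution.holomorphic_cauchy_transform[OF Q] hol Im_eq
    by (intro holomorphic_Im_zero_const holomorphic_intros open_upper_half_plane
        convex_connected convex_upper_half_plane) auto
  then obtain c where c: "\<And>z. 0 < Im z \<Longrightarrow> cauchy_transform Q z - g z = c"
    by (auto simp: constant_on_def)
  have "norm c \<le> 0 + e" if "0 < e" for e
  proof -
    \<comment> \<open>At this height the two bounds 1 / Im z add up to e.\<close>
    define z where "z = Complex 0 (2 / e)"
    have z: "0 < Im z" using that by (simp add: z_def)
    have "norm c \<le> 1 / Im z + 1 / Im z"
      using norm_triangle_ineq4[of "cauchy_transform Q z" "g z"] bound[OF z]
        real_distribution.norm_cauchy_transform_le[OF Q z] unfolding c[OF z] by linarith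
    then show ?thesis using that by (simp add: z_def)
  qed
  then have "norm c \<le> 0" by (rule field_le_epsilon)
  with c have "\<And>z. 0 < Im z \<Longrightarrow> cauchy_transform Q z = g z" by auto
  with Q that show thesis by blast
qed

subsection \<open>Convolution with a semicircle law\<close>

text \<open>R is the free convolution of M with the semicircle law of variance t. The map
  \<open>H\<close> is a bijection from \<open>S\<close>, the part of the half-plane that
  \<open>H\<close> keeps there, onto the half-plane, and the Cauchy transform of R is that of M
  after the inverse of \<open>H\<close>.\<close>

lemma (in real_distribution) semicircle_subordination:
  fixes t :: real
  assumes t: "0 \<le> t"
  obtains R where "real_distribution R"
    "\<And>w. 0 < Im w \<Longrightarrow> 0 < Im (w + of_real t * cauchy_transform M w) \<Longrightarrow>
        cauchy_transform R (w + of_real t * cauchy_transform M w) = cauchy_transform M w"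
proof -
  let ?G = "cauchy_transform M"
  define H where "H w = w + of_real t * ?G w" for w
  define S where "S = {w. 0 < Im w} \<inter> H -` {w. 0 < Im w}"
  define J where "J w = (LINT x|M. 1 / (norm (w - of_real x))\<^sup>2)" for w :: complex
  have holH: "H holomorphic_on {w. 0 < Im w}"
    unfolding H_def[abs_def] by (intro holomorphic_intros holomorphic_cauchy_transform)
  have "open S"
    unfolding S_def using continuous_open_preimage[OF holomorphic_on_imp_continuous_on[OF holH]
      open_upper_half_plane open_upper_half_plane] .
  have intJ: "integrable M (\<lambda>x. 1 / (norm (w - of_real x))\<^sup>2)" if w: "0 < Im w" for w
  proof -
    have "integrable M (\<lambda>x. 1 / Im w * (Im w / (norm (w - of_real x))\<^sup>2))"
      using w by (intro Bochner_Integration.integrable_mult_right integrable_poisson_kernel)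
    then show ?thesis using w by simp
  qed
  \<comment> \<open>Im H(w) = Im w (1 - t J(w)), so \<open>S\<close> is exactly where a
    contraction-type bound holds.\<close>
  have J: "t * J w < 1" if "w \<in> S" for w
  proof -
    have w: "0 < Im w" "0 < Im (H w)" using that by (auto simp: S_def)
    have "Im (?G w) = - (LINT x|M. Im w * (1 / (norm (w - of_real x))\<^sup>2))"
      using w by (simp add: Im_cauchy_transform)
    also have "\<dots> = - (Im w * J w)" by (simp only: J_def integral_mult_right_zero)
    finally have "Im (H w) = Im w * (1 - t * J w)" by (simp add: H_def algebra_simps)
    then show ?thesis using w by (simp add: zero_less_mult_iff)
  qed
  \<comment> \<open>By the resolvent identity, two points with the same image force t I = 1. The
    pointwise inequality p q \<le> (p^2 + q^2) / 2 bounds |I| by the mean of J(v) and J(w), hence t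
    |I| < 1.\<close>
  have inj: "inj_on H S"
  proof (rule inj_onI, rule ccontr)
    fix v w assume vw: "v \<in> S" "w \<in> S" "H v = H w" "v \<noteq> w"
    then have pos: "0 < Im v" "0 < Im w" by (auto simp: S_def)
    define I where "I = (LINT x|M. 1 / ((v - of_real x) * (w - of_real x)))"
    have "v - w = t * (?G w - ?G v)"
      using vw(3) by (simp add: H_def algebra_simps)
    also have "\<dots> = (v - w) * (t * I)"
    proof -
      have "?G w - ?G v = (v - w) * I"
        using cauchy_transform_diff[OF pos, folded I_def] by (metis minus_diff_eq mult_minus_left)
      then show ?thesis by simp
    qed
    finally have "t * I = 1" using vw(4) by simp
    then have one: "1 = t * norm I" using t by (metis abs_of_nonneg norm_mult norm_of_real norm_one)
    have "norm I \<le> (LINT x|M. 1 / 2 * (1 / (norm (v - of_real x))\<^sup>2) + 1 / 2 * (1 / (norm (w - of_real x))\<^sup>2))"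
      unfolding I_def
    proof (rule order_trans[OF integral_norm_bound integral_mono])
      show "integrable M (\<lambda>x. norm (1 / ((v - of_real x) * (w - of_real x))))"
        using pos by (intro integrable_norm) simp
      show "integrable M (\<lambda>x. 1 / 2 * (1 / (norm (v - of_real x))\<^sup>2) + 1 / 2 * (1 / (norm (w - of_real x))\<^sup>2))"
        using pos by (intro Bochner_Integration.integrable_add Bochner_Integration.integrable_mult_right intJ)
      fix x
      define p q where "p = 1 / norm (v - of_real x)" and "q = 1 / norm (w - of_real x)"
      have "p * q \<le> 1 / 2 * p\<^sup>2 + 1 / 2 * q\<^sup>2"
        using sum_squares_bound[of p q] by (simp add: field_simps)
      then show "norm (1 / ((v - of_real x) * (w - of_real x)))
          \<le> 1 / 2 * (1 / (norm (v - of_real x))\<^sup>2) + 1 / 2 * (1 / (norm (w - of_real x))\<^sup>2)"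
        by (simp add: p_def q_def norm_divide norm_mult power_divide)
    qed
    also have "\<dots> = 1 / 2 * J v + 1 / 2 * J w"
      unfolding J_def using pos intJ
      by (subst Bochner_Integration.integral_add) (auto simp only: integral_mult_right_zero intro: Bochner_Integration.integrable_mult_right)
    finally have "1 \<le> t * (1 / 2 * J v + 1 / 2 * J w)"
      unfolding one using t by (rule mult_left_mono)
    then have "1 \<le> 1 / 2 * (t * J v) + 1 / 2 * (t * J w)" by (simp add: algebra_simps)
    then show False using J[OF vw(1)] J[OF vw(2)] by simp
  qed
  have surj: "z \<in> H ` S" if z: "0 < Im z" for z
  proof -
    \<comment> \<open>Invariant under w \<mapsto> z - t G(w): Im G < 0 keeps the imaginary part at
      least Im z, and there |G| \<le> 1 / Im z. Its fixed points are the solutions of H(w) =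
      z.\<close>
    define B where "B = cball z (t / Im z) \<inter> {w. Im z \<le> Im w}"
    have B: "0 < Im w" "Im z \<le> Im w" if "w \<in> B" for w using that z by (auto simp: B_def)
    obtain w where w: "w \<in> B" "z - of_real t * ?G w = w"
    proof (rule brouwer[of B "\<lambda>w. z - of_real t * ?G w"])
      show "compact B" unfolding B_def by (intro compact_Int_closed compact_cball closed_halfspace_Im_ge)
      show "convex B" unfolding B_def by (intro convex_Int convex_cball convex_halfspace_Im_ge)
      have "z \<in> B" using z t by (simp add: B_def)
      then show "B \<noteq> {}" by blast
      show "continuous_on B (\<lambda>w. z - of_real t * ?G w)"
        using B by (intro continuous_intros continuous_on_subset[OF holomorphic_on_imp_continuous_on[OF
            holomorphic_cauchy_transform]]) auto
      show "(\<lambda>w. z - of_real t * ?G w) \<in> B \<rightarrow> B"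
      proof
        fix w assume w: "w \<in> B"
        have "norm (?G w) \<le> 1 / Im z"
          using B[OF w] z by (intro order_trans[OF norm_cauchy_transform_le[OF B(1)[OF w]]] frac_le) auto
        then have "t * norm (?G w) \<le> t * (1 / Im z)" using t by (rule mult_left_mono)
        moreover have "0 \<le> - (t * Im (?G w))"
          using t Im_cauchy_transform_neg[OF B(1)[OF w]] by (simp add: mult_nonneg_nonpos)
        ultimately show "z - of_real t * ?G w \<in> B"
          using t by (simp add: B_def dist_norm norm_mult)
      qed
    qed
    then have "H w = z" by (simp add: H_def algebra_simps)
    moreover from this have "w \<in> S" using B[OF w(1)] z by (simp add: S_def)
    ultimately show ?thesis by blast
  qed
  then have image: "H ` S = {z. 0 < Im z}" by (auto simp: S_def)
  have "H holomorphic_on S" by (rule holomorphic_on_subset[OF holH]) (auto simp: S_def)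
  then obtain k where k: "k holomorphic_on {z. 0 < Im z}" "\<And>w. w \<in> S \<Longrightarrow> k (H w) = w"
    using holomorphic_has_inverse[OF _ \<open>open S\<close> inj] unfolding image by metis
  have kS: "k z \<in> S" "H (k z) = z" if "0 < Im z" for z
    using surj[OF that] k(2) by auto
  have Im_k: "Im z \<le> Im (k z)" if z: "0 < Im z" for z
  proof -
    have "0 < Im (k z)" using kS(1)[OF z] by (simp add: S_def)
    then have "t * Im (?G (k z)) \<le> 0"
      using t Im_cauchy_transform_neg[of "k z"] by (simp add: mult_nonneg_nonpos)
    moreover have "Im z = Im (k z) + t * Im (?G (k z))"
      using arg_cong[OF kS(2)[OF z], of Im] by (simp add: H_def)
    ultimately show ?thesis by simp
  qed
  have "\<exists>R. real_distribution R \<and> (\<forall>z. 0 < Im z \<longrightarrow> cauchy_transform R z = ?G (k z))"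
  proof -
    have hol: "(\<lambda>z. ?G (k z)) holomorphic_on {z. 0 < Im z}"
      using kS(1) by (intro holomorphic_on_compose_gen[OF k(1) holomorphic_cauchy_transform, unfolded o_def])
        (auto simp: S_def)
    have neg: "Im (?G (k z)) \<le> 0" if "0 < Im z" for z
      using Im_cauchy_transform_neg[of "k z"] Im_k[OF that] that by simp
    have bound: "norm (?G (k z)) \<le> 1 / Im z" if "0 < Im z" for z
    proof -
      have "norm (?G (k z)) \<le> 1 / Im (k z)"
        using Im_k[OF that] that by (intro norm_cauchy_transform_le) simp
      also have "\<dots> \<le> 1 / Im z" using Im_k[OF that] that by (intro frac_le) auto
      finally show ?thesis .
    qed
    have lim: "((\<lambda>y. y * Im (?G (k (Complex 0 y)))) \<longlongrightarrow> -1) at_top"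
    proof (rule tendstoI)
      fix e :: real assume "0 < e"
      obtain b where b: "0 < b" "\<And>z. z \<in> truncated_cone 1 b \<Longrightarrow> norm (z * ?G z - 1) \<le> e / 3"
        using mult_cauchy_transform_near_1[of 1 "e / 3"] \<open>0 < e\<close> by auto
      \<comment> \<open>y > t + 1 makes |k(z) - z| \<le> t / y < 1, so k(z) is in the cone of
        aperture 1; y > 3 t / e makes the correction t g^2 in z g = k(z) g + t g^2 smaller than e /
        3.\<close>
      have ev: "\<forall>\<^sub>F y in at_top. max b (t + 1) < y \<and> 3 * t / e < y"
        by (intro eventually_conj eventually_gt_at_top)
      then show "\<forall>\<^sub>F y in at_top. dist (y * Im (?G (k (Complex 0 y)))) (-1) < e"
      proof eventually_elim
        case (elim y)
        then have y: "b < y" "t + 1 < y" "3 * t / e < y" "1 < y" using t by auto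
        define z where "z = Complex 0 y"
        define g where "g = ?G (k z)"
        have zy: "Re z = 0" "Im z = y" by (auto simp: z_def)
        then have z: "0 < Im z" using y by simp
        have g: "norm g \<le> 1 / y" using bound[OF z] by (simp add: g_def zy)
        have kz: "k z = z - t * g" using kS(2)[OF z] by (simp add: H_def g_def algebra_simps)
        have "norm (t * g) \<le> t / y"
          using g t mult_left_mono[OF g, of t] by (simp add: norm_mult)
        also have "\<dots> < 1" using y t by simp
        finally have "norm (t * g) < 1" .
        then have "\<bar>Re (k z)\<bar> < 1"
          using abs_Re_le_cmod[of "t * g"] by (simp add: kz zy)
        then have "k z \<in> truncated_cone 1 b"
          using Im_k[OF z] y by (simp add: mem_truncated_cone zy)
        then have 1: "norm (k z * g - 1) \<le> e / 3" using b(2) by (simp add: g_def)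
        have "norm (t * g * g) \<le> t * (1 / y) * (1 / y)"
          unfolding norm_mult using g t y by (intro mult_mono) auto
        also have "\<dots> \<le> t * (1 / y) * 1" using y t by (intro mult_left_mono) auto
        also have "\<dots> < e / 3" using y \<open>0 < e\<close> by (simp add: field_simps)
        finally have 2: "norm (t * g * g) < e / 3" .
        have "norm (z * g - 1) \<le> norm (k z * g - 1) + norm (t * g * g)"
          using norm_triangle_ineq[of "k z * g - 1" "t * g * g"] by (simp add: kz algebra_simps)
        with 1 2 have "norm (z * g - 1) < e" using \<open>0 < e\<close> by linarith
        moreover have "Re (z * g - 1) = - (y * Im g) - 1" by (simp add: zy)
        ultimately have "\<bar>- (y * Im g) - 1\<bar> < e" using abs_Re_le_cmod[of "z * g - 1"] by simp
        then show ?case by (simp add: dist_real_def g_def z_def abs_if split: if_splits)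
      qed
    qed
    show ?thesis by (rule cauchy_transform_characterization[OF hol neg bound lim]) auto
  qed
  then obtain R where R: "real_distribution R" "\<And>z. 0 < Im z \<Longrightarrow> cauchy_transform R z = ?G (k z)" by blast
  show thesis
  proof (rule that[OF R(1)])
    fix w assume "0 < Im w" "0 < Im (w + of_real t * ?G w)"
    then have "w \<in> S" "0 < Im (H w)" by (auto simp: S_def H_def)
    then have "cauchy_transform R (H w) = ?G w" using R(2) k(2) by simp
    then show "cauchy_transform R (w + of_real t * ?G w) = ?G w" by (simp add: H_def)
  qed
qed

lemma norm_real_divide_le:
  assumes z: "z \<in> truncated_cone a b" and "0 \<le> t" "0 < e" "1 + t / e \<le> b"
  shows "norm (of_real t / z) \<le> e * norm z"
proof -
  have te: "0 \<le> t / e" using assms by simp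
  have "b < norm z" using z abs_Im_le_cmod[of z] by (auto simp: mem_truncated_cone)
  then have 1: "1 \<le> norm z" "t / e \<le> norm z" using assms te by linarith+
  then have "t / e \<le> norm z * norm z"
    using mult_mono[of 1 "norm z" "t / e" "norm z"] te by simp
  then have "t \<le> e * norm z * norm z" using \<open>0 < e\<close> by (simp add: field_simps)
  then show ?thesis using 1 \<open>0 \<le> t\<close> by (subst norm_divide) (simp add: divide_le_eq)
qed

lemma real_divide_tendsto_zero_truncated_cone:
  assumes "0 < a" "0 < b" "0 \<le> t"
  shows "((\<lambda>z. of_real t / z / z) \<longlongrightarrow> 0) (inf at_infinity (principal (truncated_cone a b)))"
  unfolding tendsto_zero_truncated_cone_iff[OF assms(1,2)]
proof (intro allI impI)
  fix e :: real assume "0 < e"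
  then show "\<exists>b'\<ge>b. \<forall>z\<in>truncated_cone a b'. norm (of_real t / z) \<le> e * norm z"
    using assms by (intro exI[of _ "max b (1 + t / e)"]) (auto intro!: norm_real_divide_le[where b = "max b (1 + t / e)"])
qed

text \<open>At w = z + \<phi>(z) the Cauchy transform of M is 1 / z, so the subordination map sends
  w to z + \<phi>(z) + t / z, where the Cauchy transform of R is again 1 / z.\<close>

lemma (in real_distribution) semicircle_convolution_exists:
  assumes \<phi>: "is_voiculescu_transform M a b \<phi>" and "0 < a" "0 < b" and t: "0 \<le> t"
  obtains R b' where "real_distribution R" "b \<le> b'"
    "is_voiculescu_transform R a b' (\<lambda>z. \<phi> z + of_real t / z)"
proof -
  obtain R where R: "real_distribution R"
    "\<And>w. 0 < Im w \<Longrightarrow> 0 < Im (w + of_real t * cauchy_transform M w) \<Longrightarrow>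
        cauchy_transform R (w + of_real t * cauchy_transform M w) = cauchy_transform M w"
    using semicircle_subordination[OF t] by blast
  \<comment> \<open>Both \<phi>(z) and t / z are at most e |z|; together they must stay within the
    relative error 1 / (4 (1 + a)) that keeps the imaginary part positive.\<close>
  define e where "e = 1 / (8 * (1 + a))"
  have e: "0 < e" "2 * e * (1 + a) \<le> 1 / 4" using \<open>0 < a\<close> by (auto simp: e_def field_simps)
  obtain b1 where b1: "b \<le> b1" "\<And>z. z \<in> truncated_cone a b1 \<Longrightarrow> norm (\<phi> z) \<le> e * norm z"
    using is_voiculescu_transform_near_id[OF \<phi> \<open>0 < a\<close> \<open>0 < b\<close> e(1)] by blast
  define b' where "b' = max b1 (1 + t / e)"
  have b': "b \<le> b'" "b1 \<le> b'" "1 + t / e \<le> b'" "0 < b'" using b1 \<open>0 < b\<close> by (auto simp: b'_def)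
  have \<phi>': "is_voiculescu_transform M a b' \<phi>"
    using is_voiculescu_transform_restrict[OF \<phi> order_refl \<open>0 < b\<close> b'(1)] .
  have "is_voiculescu_transform R a b' (\<lambda>z. \<phi> z + of_real t / z)"
    unfolding is_voiculescu_transform_def
  proof (intro conjI ballI)
    show "(\<lambda>z. \<phi> z + of_real t / z) holomorphic_on truncated_cone a b'"
      using \<phi>' b' unfolding is_voiculescu_transform_def
      by (intro holomorphic_intros) (auto simp: mem_truncated_cone)
    have "((\<lambda>z. \<phi> z / z + of_real t / z / z) \<longlongrightarrow> 0 + 0) (inf at_infinity (principal (truncated_cone a b')))"
      using \<phi>' b' \<open>0 < a\<close> t unfolding is_voiculescu_transform_def
      by (intro tendsto_add real_divide_tendsto_zero_truncated_cone) auto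
    then show "((\<lambda>z. (\<phi> z + of_real t / z) / z) \<longlongrightarrow> 0) (inf at_infinity (principal (truncated_cone a b')))"
      by (simp add: add_divide_distrib)
  next
    fix z assume z: "z \<in> truncated_cone a b'"
    then have pos: "0 < Im z" using b' by (simp add: mem_truncated_cone)
    have "norm (\<phi> z) \<le> e * norm z" using b1(2) z b'(2) by (simp add: mem_truncated_cone)
    then have "norm (z + (\<phi> z + of_real t / z) - z) \<le> 2 * e * norm z"
      using norm_triangle_ineq[of "\<phi> z" "of_real t / z"] norm_real_divide_le[OF z t e(1) b'(3)] by simp
    then have "Im z / 2 \<le> Im (z + (\<phi> z + of_real t / z))"
      using e b' \<open>0 < a\<close> by (intro truncated_cone_perturb(2)[OF z]) auto
    then show Im_pos: "0 < Im (z + (\<phi> z + of_real t / z))" using pos by linarith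
    have G: "cauchy_transform M (z + \<phi> z) = 1 / z"
      using is_voiculescu_transform_cauchy[OF \<phi>' z] .
    have "0 < Im (z + \<phi> z)" using \<phi>' z unfolding is_voiculescu_transform_def by blast
    then have "cauchy_transform R (z + \<phi> z + t * cauchy_transform M (z + \<phi> z)) = cauchy_transform M (z + \<phi> z)"
      using Im_pos by (intro R(2)) (auto simp: G add.assoc)
    then show "reciprocal_cauchy_transform R (z + (\<phi> z + of_real t / z)) = z"
      unfolding G reciprocal_cauchy_transform_def by (simp add: add.assoc)
  qed
  with R(1) b'(1) that show thesis by blast
qed

subsection \<open>The semicircle law\<close>

text \<open>Here \<open>A\<close> is an antiderivative of the integrand after the substitution \<open>x = 2 cos \<theta>\<close>.\<close>

lemma semicircle_integral_antiderivative:
  fixes k :: "real \<Rightarrow> complex" and A :: "real \<Rightarrow> complex"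
  assumes k: "continuous_on UNIV k"
    and A: "\<And>\<theta>. (A has_vector_derivative (of_real (2 / pi * (sin \<theta>)\<^sup>2) * k (2 * cos \<theta>))) (at \<theta>)"
  shows "integrable lborel (\<lambda>x. (indicator {-2..2} x * (sqrt (4 - x\<^sup>2) / (2 * pi))) *\<^sub>R k x)"
    and "(LINT x|lborel. (indicator {-2..2} x * (sqrt (4 - x\<^sup>2) / (2 * pi))) *\<^sub>R k x) = A pi - A 0"
proof -
  define f where "f x = (sqrt (4 - x\<^sup>2) / (2 * pi)) *\<^sub>R k x" for x
  have "continuous_on {-2..2} f"
    unfolding f_def by (intro continuous_intros continuous_on_subset[OF k]) auto
  then have set_int: "set_integrable lborel {-2..2} f" by (rule borel_integrable_atLeastAtMost')
  then show "integrable lborel (\<lambda>x. (indicator {-2..2} x * (sqrt (4 - x\<^sup>2) / (2 * pi))) *\<^sub>R k x)"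
    by (simp add: set_integrable_def f_def)
  have contA: "continuous_on UNIV A"
    using A by (intro continuous_at_imp_continuous_on) (auto intro: has_vector_derivative_continuous)
  \<comment> \<open>The derivative of arccos blows up at the endpoints, hence the version of the
    fundamental theorem that asks for differentiability only inside. The minus sign accounts for
    arccos being decreasing.\<close>
  have "(f has_integral (- (A \<circ> (\<lambda>x. arccos (x / 2))) 2) - (- (A \<circ> (\<lambda>x. arccos (x / 2))) (-2))) {-2..2}"
  proof (rule fundamental_theorem_of_calculus_interior[where f = "\<lambda>x. - (A \<circ> (\<lambda>x. arccos (x / 2))) x"])
    show "continuous_on {-2..2} (\<lambda>x. - (A \<circ> (\<lambda>x. arccos (x / 2))) x)"
      unfolding o_def by (intro continuous_intros continuous_on_compose2[OF contA]) auto
  next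
    fix x :: real assume "x \<in> {-2<..<2}"
    then have x: "-1 < x / 2" "x / 2 < 1" by auto
    define s where "s = sqrt (1 - (x / 2)\<^sup>2)"
    have "(x / 2)\<^sup>2 < 1" using x by (simp add: abs_square_less_1)
    then have s: "0 < s" by (simp add: s_def)
    have "((\<lambda>x. arccos (x / 2)) has_vector_derivative (1 / 2 * inverse (- s))) (at x)"
    proof -
      have "((\<lambda>x. x / 2) has_real_derivative 1 / 2) (at x)" by (auto intro!: derivative_eq_intros)
      from DERIV_chain2[where g = "\<lambda>x. x / 2", OF DERIV_arccos[OF x] this]
      show ?thesis
        by (simp only: s_def mult.commute has_real_derivative_iff_has_vector_derivative)
    qed
    from vector_diff_chain_at[OF this A]
    have "((\<lambda>x. - (A \<circ> (\<lambda>x. arccos (x / 2))) x) has_vector_derivative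
        - ((1 / 2 * inverse (- s)) *\<^sub>R (of_real (2 / pi * (sin (arccos (x / 2)))\<^sup>2) * k (2 * cos (arccos (x / 2)))))) (at x)"
      by (rule has_vector_derivative_minus)
    moreover have "sin (arccos (x / 2)) = s" "cos (arccos (x / 2)) = x / 2"
      using x by (auto simp: s_def sin_arccos cos_arccos)
    moreover have "sqrt (4 - x\<^sup>2) = 2 * s"
    proof -
      have "4 - x\<^sup>2 = 4 * (1 - (x / 2)\<^sup>2)" by (simp add: power_divide)
      then show ?thesis by (simp only: s_def real_sqrt_mult real_sqrt_four)
    qed
    moreover have "- ((1 / 2 * inverse (- s)) *\<^sub>R (of_real (2 / pi * s\<^sup>2) * k (2 * (x / 2)))) = (2 * s / (2 * pi)) *\<^sub>R k x"
      using s by (simp add: scaleR_conv_of_real field_simps power2_eq_square)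
    ultimately show "((\<lambda>x. - (A \<circ> (\<lambda>x. arccos (x / 2))) x) has_vector_derivative f x) (at x)"
      by (simp only: f_def)
  qed auto
  then have "integral {-2..2} f = A pi - A 0" by (simp add: integral_unique)
  then show "(LINT x|lborel. (indicator {-2..2} x * (sqrt (4 - x\<^sup>2) / (2 * pi))) *\<^sub>R k x) = A pi - A 0"
    using set_borel_integral_eq_integral(2)[OF set_int] by (simp add: set_lebesgue_integral_def f_def)
qed

lemma semicircle_density_nonneg:
  "0 \<le> (indicator {-2..2} x * (sqrt (4 - x\<^sup>2) / (2 * pi)) :: real)"
proof (cases "x \<in> {-2..2}")
  case True
  then have "\<bar>x\<bar> \<le> 2" by auto
  then have "x\<^sup>2 \<le> 2\<^sup>2" by (subst power2_le_iff_abs_le) auto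
  then show ?thesis by simp
qed simp

lemma real_distribution_semicircle: "real_distribution semicircle_distribution"
proof -
  define f :: "real \<Rightarrow> real" where "f x = indicator {-2..2} x * (sqrt (4 - x\<^sup>2) / (2 * pi))" for x
  define A :: "real \<Rightarrow> complex" where "A \<theta> = of_real ((\<theta> - sin \<theta> * cos \<theta>) / pi)" for \<theta>
  have A: "(A has_vector_derivative (of_real (2 / pi * (sin \<theta>)\<^sup>2) * 1)) (at \<theta>)" for \<theta>
  proof -
    have "((\<lambda>\<theta>. (\<theta> - sin \<theta> * cos \<theta>) / pi) has_real_derivative (1 - (cos \<theta> * cos \<theta> - sin \<theta> * sin \<theta>)) / pi) (at \<theta>)"
      by (auto intro!: derivative_eq_intros)
    also have "(1 - (cos \<theta> * cos \<theta> - sin \<theta> * sin \<theta>)) / pi = 2 / pi * (sin \<theta>)\<^sup>2"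
      using sin_cos_squared_add[of \<theta>] by (simp add: power2_eq_square field_simps)
    finally show ?thesis
      unfolding A_def mult_1_right
      by (rule has_vector_derivative_of_real)
  qed
  note int = semicircle_integral_antiderivative[of "\<lambda>_. 1" A, OF continuous_on_const A, folded f_def]
  have f0: "0 \<le> f x" for x unfolding f_def by (rule semicircle_density_nonneg)
  have intf: "integrable lborel f"
    using integrable_Re[OF int(1)] by simp
  have "(LINT x|lborel. f x) = Re (LINT x|lborel. f x *\<^sub>R (1::complex))"
    by (subst integral_Re[OF int(1), symmetric]) simp
  also have "\<dots> = 1" unfolding int(2) by (simp add: A_def)
  finally have mass: "(LINT x|lborel. f x) = 1" .
  have "emeasure semicircle_distribution (space semicircle_distribution) = (\<integral>\<^sup>+ x. ennreal (f x) \<partial>lborel)"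
    by (simp add: semicircle_distribution_def emeasure_density f_def)
  also have "\<dots> = ennreal (LINT x|lborel. f x)"
    using intf f0 by (intro nn_integral_eq_integral) auto
  finally have "emeasure semicircle_distribution (space semicircle_distribution) = 1" using mass by simp
  then show ?thesis
    unfolding real_distribution_def real_distribution_axioms_def
    by (intro conjI prob_spaceI) (auto simp: semicircle_distribution_def)
qed

text \<open>With \<open>u = 1 / z\<close> the Cauchy kernel at \<open>z + 1 / z\<close> is \<open>u / ((1 - u e\<^sup>i\<^sup>\<theta>) (1 - u e\<^sup>-\<^sup>i\<^sup>\<theta>))\<close>,
  a Poisson kernel with an elementary antiderivative.\<close>

lemma poisson_kernel_antiderivative:
  fixes u :: complex
  assumes u: "norm u < 1" "u \<noteq> 0"
  defines "L \<equiv> \<lambda>\<theta>::real. of_real \<theta> + \<i> * Ln (1 - u * exp (\<i> * of_real \<theta>)) - \<i> * Ln (1 - u * exp (- (\<i> * of_real \<theta>)))"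
  shows "((\<lambda>\<theta>. (- (1 - u\<^sup>2) * L \<theta> + (1 + u\<^sup>2) * of_real \<theta> + 2 * u * of_real (sin \<theta>)) / (2 * pi * u))
     has_vector_derivative (of_real (2 / pi * (sin \<theta>)\<^sup>2) * (1 / (u + 1 / u - of_real (2 * cos \<theta>))))) (at \<theta>)"
proof -
  define F where "F t = (- (1 - u\<^sup>2) * (t + \<i> * Ln (1 - u * exp (\<i> * t)) - \<i> * Ln (1 - u * exp (- (\<i> * t))))
      + (1 + u\<^sup>2) * t + 2 * u * sin t) / (2 * pi * u)" for t
  define p q where "p = exp (\<i> * of_real \<theta>)" and "q = exp (- (\<i> * of_real \<theta>))"
  have pq: "p * q = 1" unfolding p_def q_def by (simp flip: exp_add)
  have norm1: "norm p = 1" "norm q = 1" by (auto simp: p_def q_def)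
  \<comment> \<open>|u| < 1 keeps 1 - u c in the right half-plane, so the principal logarithm is
    differentiable along the whole arc.\<close>
  have nonpos: "1 - u * c \<notin> \<real>\<^sub>\<le>\<^sub>0" if "norm c = 1" for c
  proof -
    have "norm (u * c) < 1" using that u by (simp add: norm_mult)
    then have "0 < Re (1 - u * c)" using abs_Re_le_cmod[of "u * c"] by simp
    then show ?thesis by (auto simp: complex_nonpos_Reals_iff)
  qed
  have nz: "1 - u * p \<noteq> 0" "1 - u * q \<noteq> 0"
    using nonpos[of p] nonpos[of q] norm1 by auto
  have cos: "of_real (cos \<theta>) = (p + q) / 2"
    by (simp add: p_def q_def cos_of_real[symmetric] cos_exp_eq)
  have sin2: "of_real ((sin \<theta>)\<^sup>2) = 1 - ((p + q) / 2)\<^sup>2"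
    unfolding sin_squared_eq by (simp add: cos)
  have "(F has_field_derivative
      (- (1 - u\<^sup>2) * (1 + u * p / (1 - u * p) + u * q / (1 - u * q)) + (1 + u\<^sup>2) + u * (p + q)) / (2 * pi * u))
      (at (of_real \<theta>))"
    unfolding F_def using nonpos[of p] nonpos[of q] norm1 u nz
    by (auto intro!: derivative_eq_intros simp: p_def[symmetric] q_def[symmetric] cos_of_real cos
        simp flip: p_def q_def) (simp add: field_simps)
  also have "(- (1 - u\<^sup>2) * (1 + u * p / (1 - u * p) + u * q / (1 - u * q)) + (1 + u\<^sup>2) + u * (p + q)) / (2 * pi * u) =
      of_real (2 / pi * (sin \<theta>)\<^sup>2) * (1 / (u + 1 / u - of_real (2 * cos \<theta>)))"
  proof -
    have P: "1 + u * p / (1 - u * p) + u * q / (1 - u * q) = (1 - u\<^sup>2) / ((1 - u * p) * (1 - u * q))"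
      using nz pq by (simp add: divide_simps) algebra
    have D: "(1 - u * p) * (1 - u * q) = 1 + u\<^sup>2 - u * (p + q)" using pq by algebra
    have K: "1 / (u + 1 / u - of_real (2 * cos \<theta>)) = u / ((1 - u * p) * (1 - u * q))"
    proof -
      have "of_real (2 * cos \<theta>) = p + q" by (simp add: cos)
      moreover have "u + 1 / u - (p + q) = (1 + u\<^sup>2 - u * (p + q)) / u"
        using u by (simp add: field_simps power2_eq_square)
      ultimately show ?thesis unfolding D by simp
    qed
    \<comment> \<open>Polynomial division in p + q by D = 1 + u^2 - u (p + q). This is where the
      three terms of the antiderivative come from: the remainder gives the logarithms, the quotient
      1 + u^2 + u (p + q) the other two.\<close>
    have "(- (1 - u\<^sup>2) * ((1 - u\<^sup>2) / ((1 - u * p) * (1 - u * q))) + (1 + u\<^sup>2) + u * (p + q)) =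
        4 * u\<^sup>2 * (1 - ((p + q) / 2)\<^sup>2) / ((1 - u * p) * (1 - u * q))"
      using nz D by (simp add: divide_simps) algebra
    then show ?thesis
      unfolding P K of_real_mult[of "2 / pi"] sin2 using u by (simp add: power2_eq_square)
  qed
  finally have "((\<lambda>t. F (of_real t)) has_vector_derivative
      of_real (2 / pi * (sin \<theta>)\<^sup>2) * (1 / (u + 1 / u - of_real (2 * cos \<theta>)))) (at \<theta>)"
    by (rule has_vector_derivative_real_field)
  then show ?thesis by (simp add: F_def L_def sin_of_real)
qed

text \<open>The Joukowski map z + 1 / z inverts F outside the unit disc.\<close>

lemma cauchy_transform_semicircle:
  assumes z: "1 < norm z" "0 < Im (z + 1 / z)"
  shows "cauchy_transform semicircle_distribution (z + 1 / z) = 1 / z"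
proof -
  define u where "u = 1 / z"
  have u: "norm u < 1" "u \<noteq> 0" "z + 1 / z = u + 1 / u" "0 < Im (u + 1 / u)"
    using z by (auto simp: u_def norm_divide divide_simps add.commute)
  let ?k = "\<lambda>x. 1 / (u + 1 / u - complex_of_real x)"
  let ?f = "\<lambda>x::real. indicator {-2..2} x * (sqrt (4 - x\<^sup>2) / (2 * pi)) :: real"
  have contk: "continuous_on UNIV ?k"
    using diff_real_nonzero[OF u(4)] by (intro continuous_intros) auto
  have [measurable]: "?k \<in> borel_measurable borel" by (rule borel_measurable_continuous_onI[OF contk])
  have G: "cauchy_transform semicircle_distribution (u + 1 / u) = (LINT x|lborel. ?f x *\<^sub>R ?k x)"
    unfolding cauchy_transform_def semicircle_distribution_def
    using semicircle_density_nonneg by (intro integral_density) auto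
  \<comment> \<open>At both endpoints the two logarithms cancel, so only the linear terms remain: (-
    (1 - u^2) \<pi> + (1 + u^2) \<pi>) / (2 \<pi> u) = u.\<close>
  have "exp (- (\<i> * of_real pi)) = -1" by (simp add: exp_minus)
  then have "(LINT x|lborel. ?f x *\<^sub>R ?k x) = u"
    by (subst semicircle_integral_antiderivative(2)[OF contk poisson_kernel_antiderivative[OF u(1,2)]])
      (use u in \<open>simp add: exp_pi_i' field_simps power2_eq_square\<close>)
  with G have "cauchy_transform semicircle_distribution (u + 1 / u) = u" by simp
  then show ?thesis unfolding u(3) by (simp add: u_def)
qed

lemma is_voiculescu_transform_semicircle:
  assumes "0 < a" "1 \<le> b"
  shows "is_voiculescu_transform semicircle_distribution a b (\<lambda>z. 1 / z)"
  unfolding is_voiculescu_transform_def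
proof (intro conjI ballI)
  show "(\<lambda>z. 1 / z) holomorphic_on truncated_cone a b"
    using assms by (intro holomorphic_intros) (auto simp: mem_truncated_cone)
  show "((\<lambda>z. 1 / z / z) \<longlongrightarrow> 0) (inf at_infinity (principal (truncated_cone a b)))"
    using real_divide_tendsto_zero_truncated_cone[of a b 1] assms by simp
  fix z assume "z \<in> truncated_cone a b"
  then have z: "1 < Im z" using assms by (simp add: mem_truncated_cone)
  then have n: "1 < norm z" using abs_Im_le_cmod[of z] by linarith
  have "norm (1 / z) < 1" using n by (auto simp: norm_divide divide_less_eq)
  then have "- 1 < Im (1 / z)" using abs_Im_le_cmod[of "1 / z"] by linarith
  then show pos: "0 < Im (z + 1 / z)" using z by simp
  show "reciprocal_cauchy_transform semicircle_distribution (z + 1 / z) = z"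
    unfolding reciprocal_cauchy_transform_def cauchy_transform_semicircle[OF n pos] by simp
qed

subsection \<open>Dilations\<close>

lemma real_distribution_dilation:
  assumes "real_distribution M"
  shows "real_distribution (dilation s M)"
proof -
  interpret real_distribution M by fact
  show ?thesis unfolding dilation_def by (rule real_distribution_distr) simp
qed

lemma dilation_dilation:
  assumes "real_distribution M"
  shows "dilation s (dilation t M) = dilation (s * t) M"
proof -
  interpret real_distribution M by fact
  show ?thesis unfolding dilation_def by (subst distr_distr) (auto simp: o_def mult.assoc[symmetric])
qed

lemma reciprocal_cauchy_transform_dilation:
  assumes "real_distribution M" "s \<noteq> 0"
  shows "reciprocal_cauchy_transform (dilation s M) (of_real s * w) =
    of_real s * reciprocal_cauchy_transform M w"
proof -
  interpret real_distribution M by fact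
  have "cauchy_transform (dilation s M) (of_real s * w) = (LINT x|M. 1 / of_real s * (1 / (w - of_real x)))"
    unfolding cauchy_transform_def dilation_def
    by (subst integral_distr) (auto simp: right_diff_distrib[symmetric])
  also have "\<dots> = 1 / of_real s * cauchy_transform M w"
    unfolding cauchy_transform_def by (rule integral_mult_right_zero)
  finally show ?thesis by (simp add: reciprocal_cauchy_transform_def)
qed

lemma is_voiculescu_transform_dilation:
  assumes M: "real_distribution M" and \<phi>: "is_voiculescu_transform M a b \<phi>"
    and pos: "0 < s" "0 < a" "0 < b"
  shows "is_voiculescu_transform (dilation s M) a (s * b) (\<lambda>z. of_real s * \<phi> (z / of_real s))"
proof -
  \<comment> \<open>Dilation preserves the aperture and scales the height.\<close>
  have cone: "z / of_real s \<in> truncated_cone a b' \<longleftrightarrow> z \<in> truncated_cone a (s * b')" for z b'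
    using pos by (simp add: mem_truncated_cone Re_divide_of_real Im_divide_of_real divide_simps mult.commute)
  have sb: "0 < s * b" using pos by simp
  show ?thesis
    unfolding is_voiculescu_transform_def tendsto_zero_truncated_cone_iff[OF pos(2) sb]
  proof (intro conjI ballI allI impI)
    have "\<phi> holomorphic_on truncated_cone a b" using \<phi> unfolding is_voiculescu_transform_def by blast
    then show "(\<lambda>z. of_real s * \<phi> (z / of_real s)) holomorphic_on truncated_cone a (s * b)"
      by (intro holomorphic_on_mult holomorphic_on_const
          holomorphic_on_compose_gen[of "\<lambda>z. z / of_real s" _ \<phi> "truncated_cone a b", unfolded o_def])
        (use pos cone in \<open>auto intro!: holomorphic_intros\<close>)
  next
    fix z assume "z \<in> truncated_cone a (s * b)"
    then have "z / of_real s \<in> truncated_cone a b" by (simp add: cone)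
    then have v: "0 < Im (z / of_real s + \<phi> (z / of_real s))"
      "reciprocal_cauchy_transform M (z / of_real s + \<phi> (z / of_real s)) = z / of_real s"
      using \<phi> unfolding is_voiculescu_transform_def by blast+
    have eq: "z + of_real s * \<phi> (z / of_real s) = of_real s * (z / of_real s + \<phi> (z / of_real s))"
      using pos by (simp add: field_simps)
    show "0 < Im (z + of_real s * \<phi> (z / of_real s))"
      unfolding eq using v(1) pos by simp
    show "reciprocal_cauchy_transform (dilation s M) (z + of_real s * \<phi> (z / of_real s)) = z"
      unfolding eq using reciprocal_cauchy_transform_dilation[OF M, of s] v(2) pos by simp
  next
    fix e :: real assume "0 < e"
    then obtain b' where b': "b \<le> b'" "\<And>z. z \<in> truncated_cone a b' \<Longrightarrow> norm (\<phi> z) \<le> e * norm z"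
      using is_voiculescu_transform_near_id[OF \<phi> pos(2,3)] by blast
    have "norm (of_real s * \<phi> (z / of_real s)) \<le> e * norm z" if "z \<in> truncated_cone a (s * b')" for z
      using b'(2)[of "z / of_real s"] that pos by (simp add: cone norm_mult norm_divide field_simps)
    then show "\<exists>b'\<ge>s * b. \<forall>z\<in>truncated_cone a b'. norm (of_real s * \<phi> (z / of_real s)) \<le> e * norm z"
      using b'(1) pos by (intro exI[of _ "s * b'"]) auto
  qed
qed

lemma is_voiculescu_transform_dilation_semicircle:
  assumes "0 < a" "0 \<le> t"
  obtains b where "0 < b"
    "is_voiculescu_transform (dilation (sqrt t) semicircle_distribution) a b (\<lambda>z. of_real t / z)"
proof (cases "t = 0")
  case True
  \<comment> \<open>The scaling rule requires a positive factor. For the Dirac measure at 0, F is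
    the identity and the transform is 0 = 0 / z.\<close>
  have "is_voiculescu_transform (return borel 0) a 1 (\<lambda>z. 0)"
    unfolding is_voiculescu_transform_def
    by (auto simp: mem_truncated_cone reciprocal_cauchy_transform_def cauchy_transform_def integral_return)
  moreover have "dilation 0 semicircle_distribution = return borel 0"
    using real_distribution_semicircle
    by (intro dilation_zero) (auto simp: real_distribution_def real_distribution_axioms_def)
  ultimately show thesis using that[of 1] True by simp
next
  case False
  then have t: "0 < t" using assms by simp
  have "is_voiculescu_transform (dilation (sqrt t) semicircle_distribution) a (sqrt t * 1)
      (\<lambda>z. of_real (sqrt t) * (1 / (z / of_real (sqrt t))))"
    using t assms by (intro is_voiculescu_transform_dilation real_distribution_semicircle
        is_voiculescu_transform_semicircle) auto
  also have "(\<lambda>z::complex. of_real (sqrt t) * (1 / (z / of_real (sqrt t)))) = (\<lambda>z. of_real t / z)"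
  proof
    fix z :: complex
    have "of_real (sqrt t) * of_real (sqrt t) = (of_real t :: complex)"
      using t by (simp only: of_real_mult[symmetric]) simp
    then show "of_real (sqrt t) * (1 / (z / of_real (sqrt t))) = of_real t / z" by simp
  qed
  finally show thesis using that[of "sqrt t * 1"] t by simp
qed

subsection \<open>The semigroup identity\<close>

text \<open>Evaluates the definite description. A competitor Q brings its own cone and its own
  transforms of the two factors; these agree with \<phi> and t / z in a smaller common cone, so
  there Q has the same transform as R.\<close>

lemma free_convolution_semicircle_eqI:
  assumes M: "real_distribution M" and R: "real_distribution R"
    and M\<phi>: "is_voiculescu_transform M a b \<phi>"
    and R\<phi>: "is_voiculescu_transform R a b (\<lambda>z. \<phi> z + of_real t / z)"
    and pos: "0 < a" "0 < b" "0 \<le> t"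
  shows "M \<boxplus> dilation (sqrt t) semicircle_distribution = R"
  unfolding free_convolution_def
proof (rule the_equality)
  let ?N = "dilation (sqrt t) semicircle_distribution"
  have N: "real_distribution ?N"
    by (intro real_distribution_dilation real_distribution_semicircle)
  obtain b0 where b0: "0 < b0" "is_voiculescu_transform ?N a b0 (\<lambda>z. of_real t / z)"
    using is_voiculescu_transform_dilation_semicircle[OF pos(1,3)] by blast
  have "is_voiculescu_transform M a (max b b0) \<phi>"
    "is_voiculescu_transform ?N a (max b b0) (\<lambda>z. of_real t / z)"
    "is_voiculescu_transform R a (max b b0) (\<lambda>z. \<phi> z + of_real t / z)"
    using is_voiculescu_transform_restrict[OF M\<phi>] is_voiculescu_transform_restrict[OF b0(2)]
      is_voiculescu_transform_restrict[OF R\<phi>] b0(1) pos by simp_all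
  then show "real_distribution R \<and> (\<exists>\<alpha>>0. \<exists>\<beta>>0. \<exists>\<phi> \<psi>. is_voiculescu_transform M \<alpha> \<beta> \<phi> \<and>
      is_voiculescu_transform ?N \<alpha> \<beta> \<psi> \<and> is_voiculescu_transform R \<alpha> \<beta> (\<lambda>z. \<phi> z + \<psi> z))"
    using R pos by (intro conjI exI[of _ a] exI[of _ "max b b0"] exI[of _ \<phi>]
        exI[of _ "\<lambda>z. of_real t / z"]) auto
  fix Q
  assume "real_distribution Q \<and> (\<exists>\<alpha>>0. \<exists>\<beta>>0. \<exists>\<phi> \<psi>. is_voiculescu_transform M \<alpha> \<beta> \<phi> \<and>
      is_voiculescu_transform ?N \<alpha> \<beta> \<psi> \<and> is_voiculescu_transform Q \<alpha> \<beta> (\<lambda>z. \<phi> z + \<psi> z))"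
  then obtain \<alpha> \<beta> \<phi>' \<psi>' where Q: "real_distribution Q" "0 < \<alpha>" "0 < \<beta>"
    "is_voiculescu_transform M \<alpha> \<beta> \<phi>'" "is_voiculescu_transform ?N \<alpha> \<beta> \<psi>'"
    "is_voiculescu_transform Q \<alpha> \<beta> (\<lambda>z. \<phi>' z + \<psi>' z)" by blast
  obtain c1 where c1: "b \<le> c1" "\<beta> \<le> c1" "\<And>z. z \<in> truncated_cone (min a \<alpha>) c1 \<Longrightarrow> \<phi> z = \<phi>' z"
    using real_distribution.is_voiculescu_transform_unique[OF M M\<phi> Q(4) pos(1,2) Q(2,3)] by blast
  obtain c2 where c2: "b0 \<le> c2" "\<beta> \<le> c2"
    "\<And>z. z \<in> truncated_cone (min a \<alpha>) c2 \<Longrightarrow> of_real t / z = \<psi>' z"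
    using real_distribution.is_voiculescu_transform_unique[OF N b0(2) Q(5) pos(1) b0(1) Q(2,3)] by blast
  define c where "c = max c1 c2"
  have "is_voiculescu_transform Q (min a \<alpha>) c (\<lambda>z. \<phi>' z + \<psi>' z)"
    using c1 by (intro is_voiculescu_transform_restrict[OF Q(6) _ Q(3)]) (auto simp: c_def)
  moreover have "\<phi>' z + \<psi>' z = \<phi> z + of_real t / z" if "z \<in> truncated_cone (min a \<alpha>) c" for z
    using c1(3)[of z] c2(3)[of z] that by (simp add: mem_truncated_cone c_def)
  ultimately have "is_voiculescu_transform Q (min a \<alpha>) c (\<lambda>z. \<phi> z + of_real t / z)"
    by (subst is_voiculescu_transform_cong[of _ _ _ "\<lambda>z. \<phi>' z + \<psi>' z"]) auto
  moreover have "is_voiculescu_transform R (min a \<alpha>) c (\<lambda>z. \<phi> z + of_real t / z)"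
    using c1 by (intro is_voiculescu_transform_restrict[OF R\<phi> _ pos(2)]) (auto simp: c_def)
  ultimately show "Q = R"
    using Q(1,2) R pos c1(1)
    by (intro voiculescu_transform_determines_distribution[of Q R "min a \<alpha>" c]) (auto simp: c_def)
qed

lemma free_convolution_semicircle:
  assumes M: "real_distribution M" and \<phi>: "is_voiculescu_transform M a b \<phi>"
    and pos: "0 < a" "0 < b" "0 \<le> t"
  obtains b' where "b \<le> b'"
    "real_distribution (M \<boxplus> dilation (sqrt t) semicircle_distribution)"
    "is_voiculescu_transform (M \<boxplus> dilation (sqrt t) semicircle_distribution) a b' (\<lambda>z. \<phi> z + of_real t / z)"
proof -
  obtain R b' where R: "real_distribution R" "b \<le> b'"
    "is_voiculescu_transform R a b' (\<lambda>z. \<phi> z + of_real t / z)"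
    using real_distribution.semicircle_convolution_exists[OF M \<phi> pos] by blast
  have "is_voiculescu_transform M a b' \<phi>"
    using is_voiculescu_transform_restrict[OF \<phi> order_refl pos(2) R(2)] .
  then have "M \<boxplus> dilation (sqrt t) semicircle_distribution = R"
    using R(2) pos by (intro free_convolution_semicircle_eqI[OF M R(1) _ R(3)]) auto
  with R that show thesis by simp
qed

lemma real_distribution_std_normal: "real_distribution std_normal_distribution"
  by (rule real_dist_normal_dist)

theorem proposition3:
  fixes b c :: real
  assumes "0 \<le> b" "b \<le> 1" "0 \<le> c" "c \<le> 1"
  shows "rho (b * c) =
           dilation (sqrt c) (rho b) \<boxplus> dilation (sqrt (1 - c)) semicircle_distribution"
proof -
  define M where "M = dilation (sqrt b) std_normal_distribution"
  have M: "real_distribution M"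
    unfolding M_def by (intro real_distribution_dilation real_distribution_std_normal)
  obtain \<beta> \<phi> where \<phi>: "0 < \<beta>" "is_voiculescu_transform M 1 \<beta> \<phi>"
    using real_distribution.is_voiculescu_transform_exists[OF M, of 1] by auto
  obtain \<beta>1 where \<beta>1: "\<beta> \<le> \<beta>1" "real_distribution (rho b)"
    "is_voiculescu_transform (rho b) 1 \<beta>1 (\<lambda>z. \<phi> z + of_real (1 - b) / z)"
    using free_convolution_semicircle[OF M \<phi>(2) _ \<phi>(1), of "1 - b"] assms unfolding rho_def M_def by auto
  show ?thesis
  proof (cases "c = 0")
    \<comment> \<open>Here both sides are the Dirac measure at 0 convolved with the semicircle law;
      that \<open>rho b\<close> is a probability measure is what makes its dilation by 0 a Dirac
      measure.\<close>
    case True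
    have "dilation 0 N = return borel 0" if "real_distribution N" for N
      using that by (intro dilation_zero) (auto simp: real_distribution_def real_distribution_axioms_def)
    then show ?thesis
      using True \<beta>1(2) real_distribution_std_normal by (simp add: rho_def[of 0])
  next
    case False
    define s where "s = sqrt c"
    have s: "0 < s" "s * s = c" using False assms by (auto simp: s_def)
    define \<phi>s where "\<phi>s z = of_real s * \<phi> (z / of_real s)" for z
    have Ms: "real_distribution (dilation s M)" by (rule real_distribution_dilation[OF M])
    have Ms_eq: "dilation s M = dilation (sqrt (b * c)) std_normal_distribution"
      by (simp add: M_def s_def dilation_dilation[OF real_distribution_std_normal] real_sqrt_mult mult.commute)
    have \<phi>s: "is_voiculescu_transform (dilation s M) 1 (s * \<beta>) \<phi>s"
      unfolding \<phi>s_def using is_voiculescu_transform_dilation[OF M \<phi>(2) s(1) _ \<phi>(1)] by simp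
    have bc: "0 \<le> 1 - b * c" using assms by (simp add: mult_le_one)
    obtain \<beta>2 where \<beta>2: "s * \<beta> \<le> \<beta>2" "real_distribution (rho (b * c))"
      "is_voiculescu_transform (rho (b * c)) 1 \<beta>2 (\<lambda>z. \<phi>s z + of_real (1 - b * c) / z)"
      using free_convolution_semicircle[OF Ms \<phi>s _ _ bc] s \<phi>(1) unfolding rho_def Ms_eq by auto
    \<comment> \<open>A height at which the transforms of \<open>dilation s (rho b)\<close> and of
      \<open>rho (b * c)\<close> are both available.\<close>
    define \<gamma> where "\<gamma> = max (s * \<beta>1) \<beta>2"
    have \<gamma>: "0 < s * \<beta>1" "0 < \<beta>2" "s * \<beta>1 \<le> \<gamma>" "\<beta>2 \<le> \<gamma>"
      using s \<phi>(1) \<beta>1(1) \<beta>2(1) by (auto simp: \<gamma>_def intro: less_le_trans[OF mult_pos_pos])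
    have "is_voiculescu_transform (dilation s (rho b)) 1 (s * \<beta>1)
        (\<lambda>z. of_real s * (\<phi> (z / of_real s) + of_real (1 - b) / (z / of_real s)))"
      using \<phi>(1) \<beta>1(1) s by (intro is_voiculescu_transform_dilation[OF \<beta>1(2,3)]) auto
    also have "(\<lambda>z. of_real s * (\<phi> (z / of_real s) + of_real (1 - b) / (z / of_real s))) =
        (\<lambda>z. \<phi>s z + of_real (c * (1 - b)) / z)"
      by (simp add: \<phi>s_def fun_eq_iff distrib_left flip: s(2))
    finally have dil: "is_voiculescu_transform (dilation s (rho b)) 1 \<gamma> (\<lambda>z. \<phi>s z + of_real (c * (1 - b)) / z)"
      by (rule is_voiculescu_transform_restrict) (use \<gamma> in auto)
    \<comment> \<open>The semicircular variances add up: c (1 - b) + (1 - c) = 1 - b c.\<close>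
    have "\<phi>s z + of_real (c * (1 - b)) / z + of_real (1 - c) / z = \<phi>s z + of_real (1 - b * c) / z" for z
      by (simp add: algebra_simps add_divide_distrib diff_divide_distrib)
    then have "is_voiculescu_transform (rho (b * c)) 1 \<gamma>
        (\<lambda>z. \<phi>s z + of_real (c * (1 - b)) / z + of_real (1 - c) / z)"
      using is_voiculescu_transform_restrict[OF \<beta>2(3) order_refl \<gamma>(2,4)] by (simp only:)
    then have "dilation s (rho b) \<boxplus> dilation (sqrt (1 - c)) semicircle_distribution = rho (b * c)"
      using \<gamma> assms by (intro free_convolution_semicircle_eqI[OF real_distribution_dilation[OF \<beta>1(2)] \<beta>2(2) dil]) auto
    then show ?thesis by (simp add: s_def)
  qed
qed

end
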